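(* Let $\mathscr{R}$ be a bipotent, divisible, archimedean, complete semifield. The lattice generated by the principal corner-integral kernels in $\mathrm{PCon}(\langle\mathscr{R}\rangle)$ is the lattice of principal kernels $\mathrm{PCon}(\langle\mathscr{R}\rangle)$, and the lattice generated by the regular principal corner-integral kernels is the lattice of regular principal kernels.
   Context: Semifields are commutative, have no zero element and are not fields. Order on $\mathscr{R}$: $a\le b\iff a+b=b$; $\mathscr{R}$ is (isomorphic to) $(\mathbb{R}_{>0},\max,\cdot)$. Elements of $\mathscr{R}(x_1,\dots,x_n)$, the semifield of fractions of $\mathscr{R}[x_1,\dots,x_n]$, are regarded as functions $\mathscr{R}^n\to\mathscr{R}$. A kernel of a semifield $\mathbb S$ is a multiplicative subgroup $K$ with $xa+yb\in K$ whenever $a,b\in K$ and $x+y=1$. $\langle f\rangle$ is the smallest kernel containing $f$; such kernels are principal. $\langle\mathscr{R}\rangle$ is the kernel of $\mathscr{R}(x_1,\dots,x_n)$ generated by any $\alpha\in\mathscr{R}\setminus\{1\}$; it is a semifield, and its kernels are the kernels of $\mathscr{R}(x_1,\dots,x_n)$ contained in it. $\mathrm{PCon}(\langle\mathscr{R}\rangle)$ is the set of principal kernels of $\langle\mathscr{R}\rangle$; it is a lattice under multiplication $K_1\cdot K_2=\{ab:a\in K_1,b\in K_2\}$ and intersection. "Lattice generated by" means closure under finite products and finite intersections. Let $f=\frac{h}{g}=\frac{\sum_{i=1}^k h_i}{\sum_{j=1}^m g_j}$ with $h_i,g_j$ monomials in $\mathscr{R}[x_1,\dots,x_n]$ (a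 reduced fraction). A corner root of a polynomial is a point where its value is attained by two distinct monomials. $f$ is corner-integral if $h(x)\le g(x)$ at every corner root $x$ of $h$ and $g(x)\le h(x)$ at every corner root $x$ of $g$. $f$ is regular if for every $x\in\mathscr{R}^n$ there are $h_i,g_j$ with $h(x)=h_i(x)$, $g(x)=g_j(x)$ and $h_i\ne g_j$. A principal kernel is corner-integral if it has a corner-integral generator, and regular if it has a regular generator (regularity does not depend on the generator). *)

theory Defs
  imports
    Complex_Main
    "HOL-Library.Function_Algebras"
    "HOL-Library.Function_Division"
    "HOL-Library.Set_Algebras"
begin

section \<open>Semifields without zero\<close>

text \<open>
  Every element is invertible; the additive structure is only a commutative semigroup.
\<close>

class semifield = comm_semiring + comm_monoid_mult + inverse +
  assumes semifield_left_inverse: "inverse a * a = 1"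
    and semifield_divide_inverse: "a / b = a * inverse b"

text \<open>Functions into a semifield form a semifield under the pointwise operations.\<close>

instance "fun" :: (type, semifield) semifield
  by standard (simp_all add: fun_eq_iff semifield_left_inverse semifield_divide_inverse)

text \<open>
  The order is determined by addition, and bipotence makes it linear.
\<close>

class bipotent_semifield = semifield + ord +
  assumes bipotent: "a + b = a \<or> a + b = b"
    and le_iff_add_eq: "a \<le> b \<longleftrightarrow> a + b = b"
    and less_iff_le_neq: "a < b \<longleftrightarrow> a \<le> b \<and> a \<noteq> b"
begin

subclass linorder
proof
  fix x y z :: 'a
  show "x < y \<longleftrightarrow> x \<le> y \<and> \<not> y \<le> x"
    by (metis add.commute bipotent le_iff_add_eq less_iff_le_neq)
  show "x \<le> x"
    using bipotent le_iff_add_eq by blast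
  show "x \<le> z" if "x \<le> y" "y \<le> z"
    using that by (metis add.assoc le_iff_add_eq)
  show "x = y" if "x \<le> y" "y \<le> x"
    using that by (metis add.commute le_iff_add_eq)
  show "x \<le> y \<or> y \<le> x"
    by (metis add.commute bipotent le_iff_add_eq)
qed

end

text \<open>
  Since there is no zero, completeness is conditional, as for the positive reals.
  A nontrivial semifield of this class is isomorphic to the positive reals with
  maximum and multiplication.
\<close>

class complete_arch_div_semifield = bipotent_semifield +
  assumes divisible: "0 < n \<Longrightarrow> \<exists>b. b ^ n = a"
    and archimedean: "1 < a \<Longrightarrow> \<exists>n. b \<le> a ^ n"
    and complete: "A \<noteq> {} \<Longrightarrow> \<exists>u. \<forall>a\<in>A. a \<le> u \<Longrightarrow>
      \<exists>s. (\<forall>a\<in>A. a \<le> s) \<and> (\<forall>u. (\<forall>a\<in>A. a \<le> u) \<longrightarrow> s \<le> u)"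

section \<open>Polynomials and fractions\<close>

text \<open>
  A monomial is a pair of a coefficient and an exponent vector; a polynomial is a nonempty list
  of monomials with distinct exponent vectors (there is no zero polynomial). The order of the
  list is immaterial for everything below. Points of \<open>R\<^sup>n\<close> are functions from the finite
  index type \<open>'n\<close>.
\<close>

type_synonym ('n, 'a) monomial = "'a \<times> ('n \<Rightarrow> nat)"

definition mono_eval :: "('n::finite, 'a::semifield) monomial \<Rightarrow> ('n \<Rightarrow> 'a) \<Rightarrow> 'a" where
  "mono_eval m x = fst m * (\<Prod>i\<in>UNIV. x i ^ snd m i)"

definition is_poly :: "('n, 'a) monomial list \<Rightarrow> bool" where
  "is_poly p \<longleftrightarrow> p \<noteq> [] \<and> distinct (map snd p)"

text \<open>
  \<^const>\<open>sum_list\<close> is not available, as it needs a zero.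
\<close>

fun nonempty_sum :: "'a::semifield list \<Rightarrow> 'a" where
  "nonempty_sum [a] = a"
| "nonempty_sum (a # b # as) = a + nonempty_sum (b # as)"

definition poly_eval :: "('n::finite, 'a::semifield) monomial list \<Rightarrow> ('n \<Rightarrow> 'a) \<Rightarrow> 'a" where
  "poly_eval p x = nonempty_sum (map (\<lambda>m. mono_eval m x) p)"

definition poly_funs :: "(('n::finite \<Rightarrow> 'a::semifield) \<Rightarrow> 'a) set" where
  "poly_funs = {poly_eval p | p. is_poly p}"

definition rat_funs :: "(('n::finite \<Rightarrow> 'a::semifield) \<Rightarrow> 'a) set" where
  "rat_funs = {h / g | h g. h \<in> poly_funs \<and> g \<in> poly_funs}"

definition poly_fun_dvd ::
    "(('n::finite \<Rightarrow> 'a::semifield) \<Rightarrow> 'a) \<Rightarrow> (('n \<Rightarrow> 'a) \<Rightarrow> 'a) \<Rightarrow> bool" where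
  "poly_fun_dvd d p \<longleftrightarrow> (\<exists>q\<in>poly_funs. p = d * q)"

text \<open>
  A fraction is reduced if numerator and denominator, as polynomial functions, have no common
  factor that is not a unit. Reduced forms need not be unique when \<open>n \<ge> 2\<close>.
\<close>

definition reduced_fraction ::
    "('n::finite, 'a::semifield) monomial list \<Rightarrow> ('n, 'a) monomial list \<Rightarrow> bool" where
  "reduced_fraction h g \<longleftrightarrow> is_poly h \<and> is_poly g \<and>
    (\<forall>d\<in>poly_funs. poly_fun_dvd d (poly_eval h) \<and> poly_fun_dvd d (poly_eval g)
       \<longrightarrow> poly_fun_dvd d 1)"

definition corner_root ::
    "('n::finite, 'a::semifield) monomial list \<Rightarrow> ('n \<Rightarrow> 'a) \<Rightarrow> bool" where
  "corner_root p x \<longleftrightarrow> (\<exists>m\<in>set p. \<exists>m'\<in>set p. m \<noteq> m' \<and>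
     mono_eval m x = poly_eval p x \<and> mono_eval m' x = poly_eval p x)"

definition corner_integral ::
    "('n::finite, 'a::bipotent_semifield) monomial list \<Rightarrow> ('n, 'a) monomial list \<Rightarrow> bool" where
  "corner_integral h g \<longleftrightarrow>
     (\<forall>x. corner_root h x \<longrightarrow> poly_eval h x \<le> poly_eval g x) \<and>
     (\<forall>x. corner_root g x \<longrightarrow> poly_eval g x \<le> poly_eval h x)"

definition regular ::
    "('n::finite, 'a::semifield) monomial list \<Rightarrow> ('n, 'a) monomial list \<Rightarrow> bool" where
  "regular h g \<longleftrightarrow> (\<forall>x. \<exists>m\<in>set h. \<exists>m'\<in>set g.
     poly_eval h x = mono_eval m x \<and> poly_eval g x = mono_eval m' x \<and> m \<noteq> m')"

section \<open>Kernels\<close>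

text \<open>Here \<open>S\<close> is a subsemifield of the semifield given by the type.\<close>

definition is_kernel :: "'b::semifield set \<Rightarrow> 'b set \<Rightarrow> bool" where
  "is_kernel S K \<longleftrightarrow> K \<subseteq> S \<and> 1 \<in> K \<and> (\<forall>a\<in>K. inverse a \<in> K) \<and> (\<forall>a\<in>K. \<forall>b\<in>K. a * b \<in> K) \<and>
     (\<forall>a\<in>K. \<forall>b\<in>K. \<forall>x\<in>S. \<forall>y\<in>S. x + y = 1 \<longrightarrow> x * a + y * b \<in> K)"

text \<open>The smallest kernel of \<open>S\<close> containing \<open>f\<close>, meaningful for \<open>f \<in> S\<close>.\<close>

definition kernel_gen :: "'b::semifield set \<Rightarrow> 'b \<Rightarrow> 'b set" where
  "kernel_gen S f = \<Inter>{K. is_kernel S K \<and> f \<in> K}"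

definition PCon :: "'b::semifield set \<Rightarrow> 'b set set" where
  "PCon S = {kernel_gen S f | f. f \<in> S}"

definition corner_integral_kernel ::
    "(('n::finite \<Rightarrow> 'a::bipotent_semifield) \<Rightarrow> 'a) set \<Rightarrow> (('n \<Rightarrow> 'a) \<Rightarrow> 'a) set \<Rightarrow> bool" where
  "corner_integral_kernel S K \<longleftrightarrow> (\<exists>h g. reduced_fraction h g \<and> corner_integral h g \<and>
     poly_eval h / poly_eval g \<in> S \<and> K = kernel_gen S (poly_eval h / poly_eval g))"

definition regular_kernel ::
    "(('n::finite \<Rightarrow> 'a::semifield) \<Rightarrow> 'a) set \<Rightarrow> (('n \<Rightarrow> 'a) \<Rightarrow> 'a) set \<Rightarrow> bool" where
  "regular_kernel S K \<longleftrightarrow> (\<exists>h g. reduced_fraction h g \<and> regular h g \<and>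
     poly_eval h / poly_eval g \<in> S \<and> K = kernel_gen S (poly_eval h / poly_eval g))"

text \<open>
  Closure under binary, hence under all nonempty finite, products (of subsets, in the sense of
  \<open>Set_Algebras\<close>) and intersections.
\<close>

inductive_set lattice_generated :: "'b::times set set \<Rightarrow> 'b set set" for G where
  base: "K \<in> G \<Longrightarrow> K \<in> lattice_generated G"
| prod: "K \<in> lattice_generated G \<Longrightarrow> L \<in> lattice_generated G \<Longrightarrow> K * L \<in> lattice_generated G"
| inter: "K \<in> lattice_generated G \<Longrightarrow> L \<in> lattice_generated G \<Longrightarrow> K \<inter> L \<in> lattice_generated G"

end

theory Submission
  imports Defs
begin

text \<open>
  Taking logarithms, a function in \<open>\<langle>R\<rangle>\<close> is a bounded piecewise linear real function, and the kernel
  it generates consists of the functions dominated in absolute value by a multiple of it; products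
  and intersections of principal kernels correspond to sums and minima of absolute values. For
  \<open>f = h / g\<close>, the cell where the maxima \<open>h\<close> and \<open>g\<close> are attained by monomials \<open>m\<close> and \<open>n\<close> meets the
  zero set of \<open>f\<close> in the polyhedron cut out by \<open>m = n\<close> and by \<open>k \<le> m\<close>, \<open>l \<le> n\<close> for the other monomials
  \<open>k\<close> of \<open>h\<close> and \<open>l\<close> of \<open>g\<close>. Replacing these conditions by the bounded corner-integral fractions
  \<open>(m + n) / (n + m/b)\<close>, where \<open>b > 1\<close>, one gets finitely many functions, one for each cell, each dominating \<open>f\<close>
  and being dominated by \<open>f\<close> on its cell; hence \<open>\<langle>f\<rangle>\<close> is the intersection of their kernels.

  In the regular case the half-spaces are not available. Only cells with \<open>m \<noteq> n\<close> are needed then, and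
  the condition \<open>k \<le> m\<close> is imposed on the hyperplane \<open>m = n\<close> by intersecting it with the tropical
  hypersurface of \<open>k + m + n\<close>, which is the zero set of the corner-integral fraction
  \<open>(k\<^sup>2 + m\<^sup>2 + n\<^sup>2) / (k m + k n + m n)\<close>, suitably truncated.
\<close>

section \<open>A logarithm for archimedean semifields\<close>

lemma add_eq_max: "a + b = max a (b::'a::bipotent_semifield)"
  by (metis add.commute le_iff_add_eq max_absorb1 max_absorb2 linear)

lemma semifield_mult_left_mono:
  fixes a b c :: "'a::bipotent_semifield"
  assumes "a \<le> b"
  shows "c * a \<le> c * b"
  using assms by (metis distrib_left le_iff_add_eq)

lemma semifield_mult_mono:
  fixes a b c d :: "'a::bipotent_semifield"
  assumes "a \<le> b" "c \<le> d"
  shows "a * c \<le> b * d"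
  using assms by (metis mult.commute order_trans semifield_mult_left_mono)

lemma semifield_right_inverse: "a * inverse a = (1::'a::semifield)"
  by (metis mult.commute semifield_left_inverse)

lemma semifield_mult_le_cancel_left:
  fixes a b c :: "'a::bipotent_semifield"
  shows "c * a \<le> c * b \<longleftrightarrow> a \<le> b"
  using semifield_mult_left_mono[of a b c] semifield_mult_left_mono[of "c * a" "c * b" "inverse c"]
  by (auto simp: semifield_left_inverse simp flip: mult.assoc)

lemma semifield_power_mono:
  fixes a b :: "'a::bipotent_semifield"
  assumes "a \<le> b"
  shows "a ^ n \<le> b ^ n"
  by (induction n) (auto intro: semifield_mult_mono assms)

lemma semifield_one_le_power:
  fixes a :: "'a::bipotent_semifield"
  assumes "1 \<le> a"
  shows "1 \<le> a ^ n"
  using semifield_power_mono[OF assms, of n] by simp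

lemma semifield_power_less_imp:
  fixes b :: "'a::bipotent_semifield"
  assumes "1 < b" "b ^ m \<le> b ^ n"
  shows "m \<le> n"
proof (rule ccontr)
  assume "\<not> m \<le> n"
  then obtain k where k: "m = n + Suc k"
    using less_imp_Suc_add[of n m] by auto
  have "b ^ n * b ^ Suc k \<le> b ^ n * 1"
    using assms(2) unfolding k power_add by (simp only: mult_1_right)
  then have "b ^ Suc k \<le> 1"
    by (simp only: semifield_mult_le_cancel_left)
  moreover have "b * 1 \<le> b * b ^ k"
    using assms(1) by (intro semifield_mult_left_mono semifield_one_le_power) simp
  ultimately show False
    using assms(1) by simp
qed

text \<open>The rationals below the logarithm of \<open>a\<close> to base \<open>b\<close>. The
  condition \<open>b^((m - n)/q) \<le> a\<close> is multiplied out so that only natural exponents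
  occur.\<close>

definition log_cut :: "'a::bipotent_semifield \<Rightarrow> 'a \<Rightarrow> real set" where
  "log_cut b a = {(real m - real n) / real q | m n q. 0 < q \<and> b ^ m \<le> a ^ q * b ^ n}"

text \<open>Raising the two inequalities to the powers \<open>q'\<close> and \<open>q\<close> brings
  them to the common denominator \<open>q * q'\<close>; then they are multiplied.\<close>

lemma log_cut_add:
  assumes "r \<in> log_cut b a" "s \<in> log_cut b c"
  shows "r + s \<in> log_cut b (a * c)"
proof -
  obtain m n q where 1: "r = (real m - real n) / real q" "0 < q" "b ^ m \<le> a ^ q * b ^ n"
    using assms(1) by (auto simp: log_cut_def)
  obtain m' n' q' where 2: "s = (real m' - real n') / real q'" "0 < q'" "b ^ m' \<le> c ^ q' * b ^ n'"
    using assms(2) by (auto simp: log_cut_def)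
  have "(b ^ m) ^ q' * (b ^ m') ^ q \<le> (a ^ q * b ^ n) ^ q' * (c ^ q' * b ^ n') ^ q"
    by (intro semifield_mult_mono semifield_power_mono 1 2)
  then have "b ^ (m * q' + m' * q) \<le> (a * c) ^ (q * q') * b ^ (n * q' + n' * q)"
    by (simp add: power_mult_distrib power_add mult_ac flip: power_mult)
  moreover have "r + s = (real (m * q' + m' * q) - real (n * q' + n' * q)) / real (q * q')"
    using 1(2) 2(2) unfolding 1(1) 2(1) by (simp add: field_simps)
  moreover have "0 < q * q'"
    using 1(2) 2(2) by simp
  ultimately show ?thesis
    unfolding log_cut_def by blast
qed

lemma log_cut_one_le:
  assumes "1 < b" "r \<in> log_cut b 1"
  shows "r \<le> 0"
proof -
  obtain m n q where "r = (real m - real n) / real q" "b ^ m \<le> b ^ n"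
    using assms(2) by (auto simp: log_cut_def)
  then show ?thesis
    using semifield_power_less_imp[OF assms(1)] by (simp add: divide_nonpos_nonneg)
qed

lemma log_cut_nonempty:
  fixes b :: "'a::complete_arch_div_semifield"
  assumes "1 < b"
  shows "log_cut b a \<noteq> {}"
proof -
  obtain n where "inverse a \<le> b ^ n"
    using archimedean[OF assms] by blast
  then have "a * inverse a \<le> a * b ^ n"
    by (rule semifield_mult_left_mono)
  then have "b ^ 0 \<le> a ^ 1 * b ^ n"
    by (simp add: semifield_right_inverse)
  then show ?thesis
    unfolding log_cut_def by blast
qed

text \<open>Adding an element of the cut of \<open>inverse a\<close> gives an element of the cut of
  \<open>1\<close>, which cannot be positive.\<close>

lemma log_cut_bdd_above:
  fixes b :: "'a::complete_arch_div_semifield"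
  assumes "1 < b"
  shows "bdd_above (log_cut b a)"
proof -
  obtain s where s: "s \<in> log_cut b (inverse a)"
    using log_cut_nonempty[OF assms] by blast
  have "r \<le> - s" if "r \<in> log_cut b a" for r
    using log_cut_one_le[OF assms] log_cut_add[OF that s] by (force simp: semifield_right_inverse)
  then show ?thesis
    by (rule bdd_aboveI)
qed

definition log_base :: "'a::bipotent_semifield \<Rightarrow> 'a \<Rightarrow> real" where
  "log_base b a = Sup (log_cut b a)"

context
  fixes b :: "'a::complete_arch_div_semifield"
  assumes b: "1 < b"
begin

lemma log_cut_le_log_base: "r \<in> log_cut b a \<Longrightarrow> r \<le> log_base b a"
  unfolding log_base_def by (intro cSup_upper log_cut_bdd_above b)

lemma log_base_superadd: "log_base b a + log_base b c \<le> log_base b (a * c)"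
proof -
  have "log_base b a \<le> log_base b (a * c) - s" if s: "s \<in> log_cut b c" for s
    unfolding log_base_def[of b a]
    using log_cut_le_log_base[OF log_cut_add[OF _ s]] log_cut_nonempty[OF b]
    by (intro cSup_least) (auto simp: algebra_simps)
  then have "log_base b c \<le> log_base b (a * c) - log_base b a"
    unfolding log_base_def[of b c] using log_cut_nonempty[OF b]
    by (intro cSup_least) (force simp: algebra_simps)+
  then show ?thesis by simp
qed

lemma log_base_one: "log_base b 1 = 0"
proof (rule antisym)
  show "log_base b 1 \<le> 0"
    unfolding log_base_def using log_cut_nonempty[OF b] log_cut_one_le[OF b]
    by (intro cSup_least)
  have "(real 0 - real 0) / real 1 \<in> log_cut b 1"
    unfolding log_cut_def by fastforce
  then show "0 \<le> log_base b 1"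
    using log_cut_le_log_base by fastforce
qed

text \<open>Superadditivity gives one inequality. If it were strict, some rational would lie
  strictly between the two sides; but the order is linear, so that rational is in the cut of
  \<open>a\<close> or its negative is in the cut of \<open>inverse a\<close>.\<close>

lemma log_base_inverse: "log_base b (inverse a) = - log_base b a"
proof (rule ccontr)
  assume "\<not> ?thesis"
  moreover have "log_base b (inverse a) + log_base b a \<le> 0"
    using log_base_superadd[of "inverse a" a] by (simp add: semifield_left_inverse log_base_one)
  ultimately have "log_base b a < - log_base b (inverse a)"
    by simp
  then obtain r where r: "log_base b a < of_rat r" "of_rat r < - log_base b (inverse a)"
    using of_rat_dense by blast
  obtain p q where pq: "r = of_int p / of_int q" "(q::int) > 0"
    by (metis Fract_of_int_quotient Rat_cases)
  \<comment> \<open>The integer numerator \<open>p\<close> is written as a difference of natural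
    numbers, as \<open>log_cut\<close> requires.\<close>
  define m n where "m = nat p" and "n = nat (- p)"
  have rmn: "of_rat r = (real m - real n) / real (nat q)"
    using pq by (auto simp: m_def n_def of_rat_divide)
  have "0 < nat q" using pq by simp
  consider "b ^ m \<le> a ^ nat q * b ^ n" | "a ^ nat q * b ^ n \<le> b ^ m"
    using linear by blast
  then show False
  proof cases
    case 1
    then have "of_rat r \<in> log_cut b a"
      using \<open>0 < nat q\<close> unfolding rmn log_cut_def by blast
    then show False
      using r(1) log_cut_le_log_base by fastforce
  next
    case 2
    have "(inverse a * a) ^ nat q * b ^ n \<le> inverse a ^ nat q * b ^ m"
      using semifield_mult_left_mono[OF 2, of "inverse a ^ nat q"]
      by (simp add: power_mult_distrib mult.assoc)
    then have "b ^ n \<le> inverse a ^ nat q * b ^ m"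
      by (simp add: semifield_left_inverse)
    then have "(real n - real m) / real (nat q) \<in> log_cut b (inverse a)"
      using \<open>0 < nat q\<close> unfolding log_cut_def by blast
    also have "(real n - real m) / real (nat q) = - of_rat r"
      unfolding rmn by (metis minus_diff_eq minus_divide_left)
    finally show False
      using r(2) log_cut_le_log_base by fastforce
  qed
qed

lemma log_base_mult: "log_base b (a * c) = log_base b a + log_base b c"
proof (rule antisym[OF _ log_base_superadd])
  have "log_base b (a * c) + log_base b (inverse a) \<le> log_base b (a * c * inverse a)"
    by (rule log_base_superadd)
  also have "a * c * inverse a = c"
    by (metis mult.commute mult.left_commute mult_1_right semifield_right_inverse)
  finally show "log_base b (a * c) \<le> log_base b a + log_base b c"
    by (simp add: log_base_inverse)
qed

text \<open>The archimedean property is applied to \<open>a\<close> here, not to the base: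
  \<open>b \<le> a^n\<close> puts \<open>1/n\<close> into the cut.\<close>

lemma log_base_pos:
  assumes "1 < a"
  shows "0 < log_base b a"
proof -
  obtain n where n: "b \<le> a ^ n"
    using archimedean[OF assms] by blast
  then have "0 < n"
    using b by (cases n) auto
  moreover have "b ^ 1 \<le> a ^ n * b ^ 0"
    using n by simp
  ultimately have "(real 1 - real 0) / real n \<in> log_cut b a"
    unfolding log_cut_def by blast
  then have "1 / real n \<le> log_base b a"
    using log_cut_le_log_base by fastforce
  moreover have "0 < 1 / real n"
    using \<open>0 < n\<close> by simp
  ultimately show ?thesis
    by linarith
qed

lemma log_base_strict_mono:
  assumes "a < c"
  shows "log_base b a < log_base b c"
proof -
  have "1 < inverse a * c"
    using assms semifield_mult_le_cancel_left[of a "inverse a * c" 1]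
    by (metis leD leI mult.assoc mult.right_neutral mult_1 semifield_right_inverse)
  then have "0 < log_base b (inverse a * c)"
    by (rule log_base_pos)
  then show ?thesis
    by (simp add: log_base_mult log_base_inverse)
qed

end

text \<open>If no element exceeds \<open>1\<close>, there are no strict inequalities at all, and the
  zero map qualifies. Including this case gives a logarithm that needs no chosen base.\<close>

lemma ex_log:
  "\<exists>l :: 'a::complete_arch_div_semifield \<Rightarrow> real.
     (\<forall>a b. l (a * b) = l a + l b) \<and> (\<forall>a b. a < b \<longrightarrow> l a < l b)"
proof (cases "\<exists>b::'a. 1 < b")
  case True
  then show ?thesis
    using log_base_mult log_base_strict_mono by blast
next
  case False
  have "\<not> a < b" for a b :: 'a
  proof
    assume "a < b"
    then have "1 < inverse a * b"
      using semifield_mult_le_cancel_left[of a "inverse a * b" 1]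
      by (metis leD leI mult.assoc mult.right_neutral mult_1 semifield_right_inverse)
    with False show False by blast
  qed
  then show ?thesis
    by (intro exI[of _ "\<lambda>_. 0"]) simp
qed

section \<open>The fixed logarithm and its rules of calculation\<close>

definition lg :: "'a::complete_arch_div_semifield \<Rightarrow> real" where
  "lg = (SOME l. (\<forall>a b. l (a * b) = l a + l b) \<and> (\<forall>a b. a < b \<longrightarrow> l a < l b))"

lemma lg_hom:
  "(\<forall>a b :: 'a::complete_arch_div_semifield. lg (a * b) = lg a + lg b) \<and>
   (\<forall>a b :: 'a. a < b \<longrightarrow> lg a < lg b)"
  unfolding lg_def by (rule someI_ex[OF ex_log])

lemma lg_mult: "lg (a * b) = lg a + lg b"
  by (simp add: lg_hom)

lemma lg_strict_mono: "a < b \<Longrightarrow> lg a < lg b"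
  by (simp add: lg_hom)

lemma lg_le_iff: "lg a \<le> lg b \<longleftrightarrow> a \<le> b"
  and lg_less_iff: "lg a < lg b \<longleftrightarrow> a < b"
  and lg_eq_iff: "lg a = lg b \<longleftrightarrow> a = b"
  using lg_strict_mono[of a b] lg_strict_mono[of b a] by (cases a b rule: linorder_cases; force)+

lemma lg_one: "lg 1 = 0"
  using lg_mult[of 1 1] by simp

lemma lg_eq_0_iff: "lg a = 0 \<longleftrightarrow> a = 1"
  using lg_eq_iff[of a 1] by (simp add: lg_one)

lemma lg_inverse: "lg (inverse a) = - lg a"
  using lg_mult[of a "inverse a"] by (simp add: semifield_right_inverse lg_one)

lemma lg_divide: "lg (a / b) = lg a - lg b"
  by (simp add: semifield_divide_inverse lg_mult lg_inverse)

lemma lg_power: "lg (a ^ n) = real n * lg a"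
  by (induction n) (auto simp: lg_mult lg_one algebra_simps)

lemma lg_add: "lg (a + b) = max (lg a) (lg b)"
  by (auto simp: add_eq_max max_def lg_le_iff)

lemma lg_prod: "lg (\<Prod>i\<in>A. f i) = (\<Sum>i\<in>A. lg (f i))"
  by (induction A rule: infinite_finite_induct) (auto simp: lg_mult lg_one)

lemmas lg_simps = lg_mult lg_one lg_inverse lg_divide lg_power lg_add

text \<open>An \<open>n\<close>-th root of \<open>b\<close> has logarithm \<open>lg b / n\<close>.
  Such elements serve later to move a point slightly.\<close>

lemma ex_small_lg:
  fixes b :: "'a::complete_arch_div_semifield"
  assumes "1 < b" "0 < e"
  shows "\<exists>t::'a. 0 < lg t \<and> lg t < e"
proof -
  have b: "0 < lg b"
    using lg_strict_mono[OF assms(1)] by (simp add: lg_one)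
  obtain n where n: "lg b / e < real n"
    using reals_Archimedean2 by blast
  then have "0 < n"
    using b assms(2) by (metis divide_pos_pos of_nat_0_less_iff order.strict_trans)
  then obtain t where "t ^ n = b"
    using divisible by blast
  then have "real n * lg t = lg b"
    by (metis lg_power)
  then have "lg t = lg b / real n"
    using \<open>0 < n\<close> by (simp add: field_simps)
  moreover have "0 < lg b / real n" "lg b / real n < e"
    using b n assms(2) \<open>0 < n\<close> by (simp_all add: field_simps)
  ultimately show ?thesis
    by metis
qed

section \<open>Kernels of semifields of functions\<close>

lemma inverse_fun_apply [simp]: "inverse f x = inverse (f x)"
  by (simp add: inverse_fun_def)

lemma divide_fun_apply [simp]: "(f / g) x = f x / g x"
  by (simp add: divide_fun_def)

lemma power_fun_apply [simp]: "(f ^ n) x = (f x :: 'a::monoid_mult) ^ n"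
  by (induction n) simp_all

text \<open>Kernels are treated relative to any such set, since the results are needed both for
  \<open>rat_funs\<close> and for \<open>bounded_rat_funs\<close>.\<close>

definition subsemifield :: "'b::semifield set \<Rightarrow> bool" where
  "subsemifield R \<longleftrightarrow>
     1 \<in> R \<and> (\<forall>a\<in>R. inverse a \<in> R) \<and> (\<forall>a\<in>R. \<forall>b\<in>R. a * b \<in> R \<and> a + b \<in> R)"

lemma subsemifieldD:
  assumes "subsemifield R"
  shows "1 \<in> R" "a \<in> R \<Longrightarrow> inverse a \<in> R" "a \<in> R \<Longrightarrow> b \<in> R \<Longrightarrow> a * b \<in> R"
    "a \<in> R \<Longrightarrow> b \<in> R \<Longrightarrow> a + b \<in> R"
  using assms by (auto simp: subsemifield_def)

text \<open>In logarithms this says that \<open>u\<close> lies in the convex subgroup generated by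
  \<open>f\<close> in a lattice-ordered group of functions; \<open>kernel_gen_eq\<close> identifies
  it with membership in the kernel of \<open>f\<close>.\<close>

definition lg_dom :: "('b \<Rightarrow> 'a::complete_arch_div_semifield) \<Rightarrow> ('b \<Rightarrow> 'a) \<Rightarrow> bool" where
  "lg_dom u f \<longleftrightarrow> (\<exists>N::nat. \<forall>x. \<bar>lg (u x)\<bar> \<le> real N * \<bar>lg (f x)\<bar>)"

lemma lg_domI:
  assumes "\<And>x. \<bar>lg (u x)\<bar> \<le> c * \<bar>lg (f x)\<bar>"
  shows "lg_dom u f"
proof -
  obtain N :: nat where "c \<le> real N"
    using real_arch_simple by blast
  then have "c * \<bar>lg (f x)\<bar> \<le> real N * \<bar>lg (f x)\<bar>" for x
    by (intro mult_right_mono) auto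
  then show ?thesis
    unfolding lg_dom_def using assms by (meson order_trans)
qed

lemma lg_dom_refl: "lg_dom f f"
  by (rule lg_domI[of _ 1]) simp

lemma lg_dom_trans:
  assumes "lg_dom u v" "lg_dom v w"
  shows "lg_dom u w"
proof -
  obtain N M :: nat where N: "\<And>x. \<bar>lg (u x)\<bar> \<le> real N * \<bar>lg (v x)\<bar>"
    and M: "\<And>x. \<bar>lg (v x)\<bar> \<le> real M * \<bar>lg (w x)\<bar>"
    using assms by (auto simp: lg_dom_def)
  have "\<bar>lg (u x)\<bar> \<le> real N * real M * \<bar>lg (w x)\<bar>" for x
  proof -
    have "real N * \<bar>lg (v x)\<bar> \<le> real N * (real M * \<bar>lg (w x)\<bar>)"
      by (intro mult_left_mono M) simp
    then show ?thesis
      using N[of x] by (simp add: mult.assoc)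
  qed
  then show ?thesis
    by (rule lg_domI)
qed

lemma lg_dom_combine:
  assumes "lg_dom u f" "lg_dom v f" "\<And>x. \<bar>lg (w x)\<bar> \<le> \<bar>lg (u x)\<bar> + \<bar>lg (v x)\<bar>"
  shows "lg_dom w f"
proof -
  obtain N M :: nat where N: "\<And>x. \<bar>lg (u x)\<bar> \<le> real N * \<bar>lg (f x)\<bar>"
    and M: "\<And>x. \<bar>lg (v x)\<bar> \<le> real M * \<bar>lg (f x)\<bar>"
    using assms(1,2) by (auto simp: lg_dom_def)
  have "\<bar>lg (w x)\<bar> \<le> (real N + real M) * \<bar>lg (f x)\<bar>" for x
    using N[of x] M[of x] assms(3)[of x] by (simp add: algebra_simps)
  then show ?thesis
    by (rule lg_domI)
qed

lemma semifield_idem_add: "a + a = (a::'a::bipotent_semifield)"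
  using bipotent by blast

text \<open>A power of \<open>f + inverse f\<close> yields \<open>v\<close> in \<open>K\<close> with
  logarithm \<open>N * \<bar>lg f\<bar>\<close>. Any \<open>w + 1\<close> with
  \<open>w \<le> v\<close> is a combination of \<open>1\<close> and \<open>v\<close> whose
  coefficients add up to \<open>1\<close>. Both \<open>u\<close> and its inverse are admissible as
  \<open>w\<close>.\<close>

lemma kernel_convex:
  fixes f u :: "'b \<Rightarrow> 'a::complete_arch_div_semifield"
  assumes R: "subsemifield R" and K: "is_kernel R K" and f: "f \<in> K" and u: "u \<in> R"
    and dom: "lg_dom u f"
  shows "u \<in> K"
proof -
  note R' = subsemifieldD[OF R]
  have inv: "inverse a \<in> K" if "a \<in> K" for a
    using K that by (auto simp: is_kernel_def)
  have mul: "a * b \<in> K" if "a \<in> K" "b \<in> K" for a b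
    using K that by (auto simp: is_kernel_def)
  have comb: "x * a + y * b \<in> K" if "a \<in> K" "b \<in> K" "x \<in> R" "y \<in> R" "x + y = 1" for a b x y
    using K that by (auto simp: is_kernel_def)
  have one: "1 \<in> K" and KR: "K \<subseteq> R"
    using K by (auto simp: is_kernel_def)
  obtain N where N: "\<And>x. \<bar>lg (u x)\<bar> \<le> real N * \<bar>lg (f x)\<bar>"
    using dom by (auto simp: lg_dom_def)
  define v where "v = (f + inverse f) ^ N"
  \<comment> \<open>By idempotence \<open>1 + 1 = 1\<close>, so both coefficients may be
    \<open>1\<close>.\<close>
  have "1 * f + 1 * inverse f \<in> K"
    by (rule comb) (auto simp: f inv R' fun_eq_iff semifield_idem_add)
  then have "f + inverse f \<in> K"
    by simp
  then have v: "v \<in> K"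
    unfolding v_def by (induction N) (auto simp: one mul)
  then have "inverse v \<in> R"
    using KR by (auto simp: R')
  have lgv: "lg (v x) = real N * \<bar>lg (f x)\<bar>" for x
    by (simp add: v_def lg_simps abs_real_def max_def)
  have between: "w + 1 \<in> K" if w: "w \<in> R" "\<And>x. lg (w x) \<le> lg (v x)" for w
  proof -
    have "(w + 1) * inverse v \<in> R"
      using w \<open>inverse v \<in> R\<close> by (simp add: R')
    moreover have "1 + (w + 1) * inverse v = 1"
    proof
      fix x
      show "(1 + (w + 1) * inverse v) x = 1 x"
        using w(2)[of x] lgv[of x] by (simp add: lg_simps flip: lg_eq_iff)
    qed
    ultimately have "1 * 1 + ((w + 1) * inverse v) * v \<in> K"
      by (rule comb[OF one v R'(1)])
    also have "1 * 1 + ((w + 1) * inverse v) * v = w + 1"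
      by (auto simp: fun_eq_iff lg_simps simp flip: lg_eq_iff)
    finally show ?thesis .
  qed
  have "u + 1 \<in> K" "inverse u + 1 \<in> K"
    using N by (auto intro!: between u R' simp: lgv lg_simps abs_le_iff)
  \<comment> \<open>In logarithms a function is its positive part minus its negative part.\<close>
  then have "(u + 1) * inverse (inverse u + 1) \<in> K"
    by (metis mul inv)
  also have "(u + 1) * inverse (inverse u + 1) = u"
    by (auto simp: fun_eq_iff lg_simps max_def simp flip: lg_eq_iff)
  finally show ?thesis .
qed

text \<open>If \<open>x + y = 1\<close>, both coefficients are at most \<open>1\<close> and at each
  point one of them equals \<open>1\<close>. Hence \<open>x * a + y * b\<close> lies pointwise
  between the minimum and the maximum of \<open>a\<close> and \<open>b\<close>.\<close>

lemma is_kernel_lg_dom: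
  fixes f :: "'b \<Rightarrow> 'a::complete_arch_div_semifield"
  assumes R: "subsemifield R"
  shows "is_kernel R {u \<in> R. lg_dom u f}"
proof -
  note R' = subsemifieldD[OF R]
  have "lg_dom (x * a + y * b) f" if "lg_dom a f" "lg_dom b f" "x + y = 1" for x y a b
  proof (rule lg_dom_combine[OF that(1,2)])
    fix z
    have "x z + y z = 1"
      using that(3) by (simp add: fun_eq_iff)
    then have "max (lg (x z)) (lg (y z)) = 0"
      by (metis lg_add lg_one)
    then show "\<bar>lg ((x * a + y * b) z)\<bar> \<le> \<bar>lg (a z)\<bar> + \<bar>lg (b z)\<bar>"
      by (simp add: lg_simps)
  qed
  moreover have "lg_dom 1 f"
    by (rule lg_domI[of _ 0]) (simp add: lg_one)
  moreover have "lg_dom (inverse a) f" if "lg_dom a f" for a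
    using that by (simp add: lg_dom_def lg_inverse)
  moreover have "lg_dom (a * b) f" if "lg_dom a f" "lg_dom b f" for a b
    by (rule lg_dom_combine[OF that]) (simp add: lg_mult)
  ultimately show ?thesis
    by (auto simp: is_kernel_def R')
qed

lemma kernel_gen_eq:
  fixes f :: "'b \<Rightarrow> 'a::complete_arch_div_semifield"
  assumes "subsemifield R" "f \<in> R"
  shows "kernel_gen R f = {u \<in> R. lg_dom u f}"
proof
  show "kernel_gen R f \<subseteq> {u \<in> R. lg_dom u f}"
    unfolding kernel_gen_def using is_kernel_lg_dom[OF assms(1)] assms(2) lg_dom_refl by blast
  show "{u \<in> R. lg_dom u f} \<subseteq> kernel_gen R f"
    unfolding kernel_gen_def using kernel_convex[OF assms(1)] by blast
qed

lemma subsemifield_lg_dom: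
  fixes f :: "'b \<Rightarrow> 'a::complete_arch_div_semifield"
  assumes R: "subsemifield R"
  shows "subsemifield {u \<in> R. lg_dom u f}"
proof -
  note R' = subsemifieldD[OF R]
  have "lg_dom (a + b) f" if "lg_dom a f" "lg_dom b f" for a b
    by (rule lg_dom_combine[OF that]) (simp add: lg_add)
  then show ?thesis
    using is_kernel_lg_dom[OF R] by (auto simp: subsemifield_def is_kernel_def R')
qed

text \<open>The generator on the right has logarithm
  \<open>\<bar>lg a\<bar> + \<bar>lg b\<bar>\<close>. A function dominated by this sum splits into
  two factors, one dominated by each summand (Riesz decomposition).\<close>

lemma kernel_gen_times:
  fixes a b :: "'b \<Rightarrow> 'a::complete_arch_div_semifield"
  assumes R: "subsemifield R" and ab: "a \<in> R" "b \<in> R"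
  shows "kernel_gen R a * kernel_gen R b = kernel_gen R ((a + inverse a) * (b + inverse b))"
    (is "?l = kernel_gen R ?c")
proof -
  note R' = subsemifieldD[OF R]
  have c: "?c \<in> R"
    using ab by (simp add: R')
  have lgc: "\<bar>lg (?c x)\<bar> = \<bar>lg (a x)\<bar> + \<bar>lg (b x)\<bar>" for x
    by (simp add: lg_simps abs_real_def max_def)
  have a: "lg_dom a ?c" and b: "lg_dom b ?c"
    unfolding lg_dom_def lgc by (rule exI[of _ 1]; simp)+
  show ?thesis
    unfolding kernel_gen_eq[OF R ab(1)] kernel_gen_eq[OF R ab(2)] kernel_gen_eq[OF R c]
  proof (intro equalityI subsetI)
    fix w assume "w \<in> {u \<in> R. lg_dom u a} * {u \<in> R. lg_dom u b}"
    then obtain u v where uv: "w = u * v" "u \<in> R" "v \<in> R" "lg_dom u a" "lg_dom v b"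
      by (auto elim!: set_times_elim)
    have "lg_dom w ?c"
      by (rule lg_dom_combine[OF lg_dom_trans[OF uv(4) a] lg_dom_trans[OF uv(5) b]])
        (simp add: uv(1) lg_mult)
    then show "w \<in> {u \<in> R. lg_dom u ?c}"
      using uv by (simp add: R')
  next
    fix w assume "w \<in> {u \<in> R. lg_dom u ?c}"
    then obtain N where w: "w \<in> R"
      and N: "\<And>x. \<bar>lg (w x)\<bar> \<le> real N * \<bar>lg (a x)\<bar> + real N * \<bar>lg (b x)\<bar>"
      unfolding lg_dom_def lgc by (auto simp: algebra_simps)
    define A where "A = (a + inverse a) ^ N"
    \<comment> \<open>This is \<open>w\<close> cut off below at \<open>inverse A\<close> and above
      at \<open>A\<close>; what the cut removes is dominated by \<open>b\<close>.\<close>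
    define u where "u = inverse (inverse (w + inverse A) + inverse A)"
    have A: "A \<in> R" unfolding A_def using ab by (induction N) (auto simp: R')
    have u: "u \<in> R" "w * inverse u \<in> R"
      unfolding u_def by (simp_all add: R' A w)
    have lgA: "lg (A x) = real N * \<bar>lg (a x)\<bar>" for x
      by (simp add: A_def lg_simps abs_real_def max_def)
    have lgu: "lg (u x) = min (max (lg (w x)) (- lg (A x))) (lg (A x))" for x
      by (simp add: u_def lg_simps)
    have "\<bar>lg (u x)\<bar> \<le> real N * \<bar>lg (a x)\<bar>" for x
    proof -
      have "0 \<le> lg (A x)"
        by (simp add: lgA)
      then show ?thesis
        unfolding lgu lgA[symmetric] by linarith
    qed
    then have "lg_dom u a"
      unfolding lg_dom_def by blast
    moreover have "lg_dom (w * inverse u) b"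
      unfolding lg_dom_def
    proof (intro exI allI)
      fix x
      have "0 \<le> lg (A x)" "0 \<le> real N * \<bar>lg (b x)\<bar>" "\<bar>lg (w x)\<bar> \<le> lg (A x) + real N * \<bar>lg (b x)\<bar>"
        using N[of x] by (simp_all add: lgA)
      then show "\<bar>lg ((w * inverse u) x)\<bar> \<le> real N * \<bar>lg (b x)\<bar>"
        unfolding times_fun_apply inverse_fun_apply lg_mult lg_inverse lgu by linarith
    qed
    moreover have "w = u * (w * inverse u)"
      by (auto simp: fun_eq_iff lg_simps simp flip: lg_eq_iff)
    ultimately show "w \<in> {u \<in> R. lg_dom u a} * {u \<in> R. lg_dom u b}"
      using u by (auto simp: set_times_def)
  qed
qed

text \<open>The generator on the right has logarithm
  \<open>min \<bar>lg a\<bar> \<bar>lg b\<bar>\<close>. If \<open>u\<close> is dominated by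
  \<open>a\<close> with factor \<open>N\<close> and by \<open>b\<close> with factor
  \<open>M\<close>, then the factor \<open>N + M\<close> works for the minimum.\<close>

lemma kernel_gen_Int:
  fixes a b :: "'b \<Rightarrow> 'a::complete_arch_div_semifield"
  assumes R: "subsemifield R" and ab: "a \<in> R" "b \<in> R"
  shows "kernel_gen R a \<inter> kernel_gen R b =
    kernel_gen R (inverse (inverse (a + inverse a) + inverse (b + inverse b)))"
    (is "_ = kernel_gen R ?c")
proof -
  note R' = subsemifieldD[OF R]
  have c: "?c \<in> R"
    using ab by (simp add: R')
  have lgc: "\<bar>lg (?c x)\<bar> = min \<bar>lg (a x)\<bar> \<bar>lg (b x)\<bar>" for x
    by (simp add: lg_simps abs_real_def max_def min_def)
  have "lg_dom ?c a" "lg_dom ?c b"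
    unfolding lg_dom_def lgc by (rule exI[of _ 1]; simp)+
  moreover have "lg_dom u ?c" if u: "lg_dom u a" "lg_dom u b" for u
  proof -
    obtain N M :: nat where "\<And>x. \<bar>lg (u x)\<bar> \<le> real N * \<bar>lg (a x)\<bar>" "\<And>x. \<bar>lg (u x)\<bar> \<le> real M * \<bar>lg (b x)\<bar>"
      using u by (auto simp: lg_dom_def)
    moreover have "real N * \<bar>lg (a x)\<bar> \<le> real (N + M) * \<bar>lg (a x)\<bar>"
      "real M * \<bar>lg (b x)\<bar> \<le> real (N + M) * \<bar>lg (b x)\<bar>" for x
      by (intro mult_right_mono; simp)+
    ultimately show ?thesis
      unfolding lg_dom_def lgc by (intro exI[of _ "N + M"]) (metis min_def order_trans)
  qed
  ultimately show ?thesis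
    unfolding kernel_gen_eq[OF R ab(1)] kernel_gen_eq[OF R ab(2)] kernel_gen_eq[OF R c]
    using lg_dom_trans by blast
qed

section \<open>Tropical polynomials\<close>

lemma lg_mono_eval:
  fixes x :: "'n::finite \<Rightarrow> 'a::complete_arch_div_semifield"
  shows "lg (mono_eval m x) = lg (fst m) + (\<Sum>i\<in>UNIV. real (snd m i) * lg (x i))"
  by (simp add: mono_eval_def lg_mult lg_prod lg_power)

lemma nonempty_sum_eq_Max:
  fixes xs :: "'a::bipotent_semifield list"
  assumes "xs \<noteq> []"
  shows "nonempty_sum xs = Max (set xs)"
  using assms by (induction xs rule: nonempty_sum.induct) (auto simp: add_eq_max)

lemma poly_eval_eq_Max:
  fixes p :: "('n::finite, 'a::bipotent_semifield) monomial list"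
  assumes "p \<noteq> []"
  shows "poly_eval p x = Max ((\<lambda>m. mono_eval m x) ` set p)"
  using assms by (simp add: poly_eval_def nonempty_sum_eq_Max)

lemma mono_eval_le_poly_eval:
  fixes p :: "('n::finite, 'a::bipotent_semifield) monomial list"
  assumes "m \<in> set p"
  shows "mono_eval m x \<le> poly_eval p x"
  using assms by (subst poly_eval_eq_Max) auto

lemma poly_eval_attained:
  fixes p :: "('n::finite, 'a::bipotent_semifield) monomial list"
  assumes "p \<noteq> []"
  obtains m where "m \<in> set p" "poly_eval p x = mono_eval m x"
proof -
  have "poly_eval p x \<in> (\<lambda>m. mono_eval m x) ` set p"
    unfolding poly_eval_eq_Max[OF assms] using assms by (intro Max_in) auto
  then show ?thesis
    using that by blast
qed

lemma poly_eval_eqI: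
  fixes p :: "('n::finite, 'a::bipotent_semifield) monomial list"
  assumes "m \<in> set p" "\<And>k. k \<in> set p \<Longrightarrow> mono_eval k x \<le> mono_eval m x"
  shows "poly_eval p x = mono_eval m x"
proof -
  have "p \<noteq> []"
    using assms(1) by auto
  then obtain k where "k \<in> set p" "poly_eval p x = mono_eval k x"
    by (rule poly_eval_attained)
  then show ?thesis
    using assms mono_eval_le_poly_eval[OF assms(1), of x] by (metis order_antisym)
qed

lemma poly_eval_append:
  fixes p q :: "('n::finite, 'a::bipotent_semifield) monomial list"
  assumes "p \<noteq> []" "q \<noteq> []"
  shows "poly_eval (p @ q) = poly_eval p + poly_eval q"
  using assms by (simp add: fun_eq_iff poly_eval_eq_Max add_eq_max image_Un Max_Un)

lemma poly_eval_single: "poly_eval [m] = mono_eval m"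
  by (simp add: poly_eval_def fun_eq_iff)

lemma poly_eval_Cons:
  assumes "p \<noteq> []"
  shows "poly_eval (m # p) = mono_eval m + poly_eval p"
  using assms by (cases p) (auto simp: poly_eval_def fun_eq_iff)

lemma mono_eval_add_coeff:
  "mono_eval (c + d, e) = mono_eval (c, e) + mono_eval (d, e)"
  by (simp add: mono_eval_def fun_eq_iff distrib_right)

text \<open>A list may repeat an exponent vector, which \<open>is_poly\<close> forbids; such
  monomials are merged by adding their coefficients.\<close>

lemma poly_eval_in_poly_funs:
  fixes p :: "('n::finite, 'a::bipotent_semifield) monomial list"
  assumes "p \<noteq> []"
  shows "poly_eval p \<in> poly_funs"
proof -
  have "\<exists>q. is_poly q \<and> poly_eval p = poly_eval q"
    using assms
  proof (induction p rule: list_nonempty_induct)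
    case (single m)
    then show ?case
      by (intro exI[of _ "[m]"]) (simp add: is_poly_def)
  next
    case (cons m p)
    then obtain q where q: "is_poly q" "poly_eval p = poly_eval q"
      by blast
    then have eq: "poly_eval (m # p) = mono_eval m + poly_eval q"
      using cons.hyps by (simp add: poly_eval_Cons)
    have "q \<noteq> []"
      using q by (simp add: is_poly_def)
    show ?case
    proof (cases "snd m \<in> snd ` set q")
      case False
      then show ?thesis
        using q eq \<open>q \<noteq> []\<close> by (intro exI[of _ "m # q"]) (auto simp: is_poly_def poly_eval_Cons)
    next
      case True
      then obtain k where k: "k \<in> set q" "snd k = snd m"
        by auto
      then obtain xs ys where xy: "q = xs @ k # ys"
        by (meson split_list)
      let ?k = "(fst m + fst k, snd k)"
      have "mono_eval ?k = mono_eval m + mono_eval k"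
        using mono_eval_add_coeff[of "fst m" "fst k" "snd k"] k(2) by (metis prod.collapse)
      then have "poly_eval (xs @ ?k # ys) = mono_eval m + poly_eval (xs @ k # ys)"
        by (cases "xs = []"; cases "ys = []")
          (simp_all add: poly_eval_append poly_eval_single poly_eval_Cons add_ac)
      moreover have "is_poly (xs @ ?k # ys)"
        using q(1) by (simp add: xy is_poly_def)
      ultimately show ?thesis
        using eq xy by metis
    qed
  qed
  then show ?thesis
    by (auto simp: poly_funs_def)
qed

lemma poly_funsE:
  assumes "f \<in> poly_funs"
  obtains p where "is_poly p" "f = poly_eval p" "p \<noteq> []"
  using assms by (auto simp: poly_funs_def is_poly_def)

lemma mono_eval_in_poly_funs: "mono_eval m \<in> poly_funs"
  unfolding poly_funs_def poly_eval_single[symmetric] by (force simp: is_poly_def)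

lemma mono_eval_const: "mono_eval (c, \<lambda>_. 0) = (\<lambda>_. c)"
  by (simp add: fun_eq_iff mono_eval_def)

lemma const_in_poly_funs: "(\<lambda>_. c) \<in> poly_funs"
  using mono_eval_in_poly_funs[of "(c, \<lambda>_. 0)"] by (simp add: mono_eval_const)

section \<open>Sums, products and quotients of polynomial functions\<close>

definition mono_mult :: "('n, 'a::semifield) monomial \<Rightarrow> ('n, 'a) monomial \<Rightarrow> ('n, 'a) monomial" where
  "mono_mult m n = (fst m * fst n, \<lambda>i. snd m i + snd n i)"

lemma mono_eval_mult: "mono_eval (mono_mult m n) x = mono_eval m x * mono_eval n x"
  by (simp add: mono_mult_def mono_eval_def power_add prod.distrib mult_ac)

lemma poly_funs_add:
  fixes f g :: "('n::finite \<Rightarrow> 'a::bipotent_semifield) \<Rightarrow> 'a"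
  assumes "f \<in> poly_funs" "g \<in> poly_funs"
  shows "f + g \<in> poly_funs"
proof -
  obtain p q where "f = poly_eval p" "p \<noteq> []" "g = poly_eval q" "q \<noteq> []"
    using assms by (metis poly_funsE)
  then show ?thesis
    using poly_eval_in_poly_funs[of "p @ q"] by (simp add: poly_eval_append)
qed

text \<open>The list of all products of monomials may repeat exponent vectors, but it still
  evaluates correctly: at each point its maximum is attained by the product of two maximal
  monomials.\<close>

lemma poly_funs_mult:
  fixes f g :: "('n::finite \<Rightarrow> 'a::bipotent_semifield) \<Rightarrow> 'a"
  assumes "f \<in> poly_funs" "g \<in> poly_funs"
  shows "f * g \<in> poly_funs"
proof -
  obtain p q where p: "f = poly_eval p" "p \<noteq> []" and q: "g = poly_eval q" "q \<noteq> []"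
    using assms by (metis poly_funsE)
  let ?r = "map (\<lambda>(m, n). mono_mult m n) (List.product p q)"
  have "?r \<noteq> []"
    using p(2) q(2) by (cases p; cases q) auto
  moreover have "poly_eval ?r x = f x * g x" for x
  proof -
    obtain m n where m: "m \<in> set p" "f x = mono_eval m x" and n: "n \<in> set q" "g x = mono_eval n x"
      using p q poly_eval_attained by metis
    have "poly_eval ?r x = mono_eval (mono_mult m n) x"
      using m n mono_eval_le_poly_eval[of _ p x] mono_eval_le_poly_eval[of _ q x] p q
      by (intro poly_eval_eqI) (auto simp: mono_eval_mult intro!: semifield_mult_mono)
    then show ?thesis
      by (simp add: mono_eval_mult m n)
  qed
  then have "poly_eval ?r = f * g"
    by (simp add: fun_eq_iff)
  ultimately show ?thesis
    using poly_eval_in_poly_funs[of ?r] by simp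
qed

lemma rat_funs_divide:
  fixes f g :: "('n::finite \<Rightarrow> 'a::bipotent_semifield) \<Rightarrow> 'a"
  shows "f \<in> poly_funs \<Longrightarrow> g \<in> poly_funs \<Longrightarrow> f / g \<in> rat_funs"
  unfolding rat_funs_def by blast

lemma subsemifield_rat_funs:
  "subsemifield (rat_funs :: (('n::finite \<Rightarrow> 'a::complete_arch_div_semifield) \<Rightarrow> 'a) set)"
    (is "subsemifield ?R")
proof -
  have "(1::('n \<Rightarrow> 'a) \<Rightarrow> 'a) = (\<lambda>_. 1) / (\<lambda>_. 1)"
    by (simp add: fun_eq_iff lg_simps flip: lg_eq_iff)
  then have "1 \<in> ?R"
    by (metis const_in_poly_funs rat_funs_divide)
  moreover have "inverse a \<in> ?R" if "a \<in> ?R" for a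
  proof -
    obtain h g where a: "a = h / g" "h \<in> poly_funs" "g \<in> poly_funs"
      using \<open>a \<in> ?R\<close> by (auto simp: rat_funs_def)
    have "inverse a = g / h"
      by (simp add: a fun_eq_iff lg_simps flip: lg_eq_iff)
    then show ?thesis
      using a rat_funs_divide by metis
  qed
  moreover have "a * b \<in> ?R" "a + b \<in> ?R" if "a \<in> ?R" "b \<in> ?R" for a b
  proof -
    obtain h g where a: "a = h / g" "h \<in> poly_funs" "g \<in> poly_funs"
      using \<open>a \<in> ?R\<close> by (auto simp: rat_funs_def)
    obtain h' g' where b: "b = h' / g'" "h' \<in> poly_funs" "g' \<in> poly_funs"
      using \<open>b \<in> ?R\<close> by (auto simp: rat_funs_def)
    have "a * b = (h * h') / (g * g')"
      by (simp add: a b fun_eq_iff lg_simps flip: lg_eq_iff)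
    then show "a * b \<in> ?R"
      using a b rat_funs_divide poly_funs_mult by metis
    have "a + b = (h * g' + h' * g) / (g * g')"
      by (simp add: a b fun_eq_iff lg_simps max_def flip: lg_eq_iff)
    then show "a + b \<in> ?R"
      using a b rat_funs_divide poly_funs_mult poly_funs_add by metis
  qed
  ultimately show ?thesis
    by (auto simp: subsemifield_def)
qed

section \<open>Corner roots\<close>

lemma finite_ex_common_pos:
  fixes Q :: "real \<Rightarrow> 'c \<Rightarrow> bool"
  assumes "finite A" "\<And>a. a \<in> A \<Longrightarrow> \<exists>e>0. Q e a"
    and "\<And>a d e. Q e a \<Longrightarrow> 0 < d \<Longrightarrow> d \<le> e \<Longrightarrow> Q d a"
  shows "\<exists>e>0. \<forall>a\<in>A. Q e a"
  using assms(1,2)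
proof (induction A rule: finite_induct)
  case empty
  then show ?case by (auto intro: exI[of _ 1])
next
  case (insert a A)
  obtain e where e: "e > 0" "\<forall>a\<in>A. Q e a"
    using insert by auto
  obtain d where d: "d > 0" "Q d a"
    using insert by auto
  have "\<forall>b\<in>insert a A. Q (min d e) b"
    using d e by (auto intro: assms(3))
  then show ?case
    using d e by (intro exI[of _ "min d e"]) auto
qed

text \<open>The open ball of the supremum norm in logarithmic coordinates.\<close>

definition near :: "real \<Rightarrow> ('n \<Rightarrow> 'a::complete_arch_div_semifield) \<Rightarrow> ('n \<Rightarrow> 'a) \<Rightarrow> bool" where
  "near e x y \<longleftrightarrow> (\<forall>i. \<bar>lg (y i) - lg (x i)\<bar> < e)"

lemma near_mono: "near d x y \<Longrightarrow> d \<le> e \<Longrightarrow> near e x y"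
  unfolding near_def by (meson order.strict_trans2)

text \<open>In logarithms monomials are affine, and the sum \<open>B\<close> of all exponents bounds
  how fast their difference changes with the coordinates. The gap \<open>D\<close> at
  \<open>x\<close> therefore survives on a ball of radius \<open>D / C\<close>.\<close>

lemma near_less:
  fixes x :: "'n::finite \<Rightarrow> 'a::complete_arch_div_semifield"
  assumes "mono_eval m x < mono_eval n x"
  shows "\<exists>e>0. \<forall>y. near e x y \<longrightarrow> mono_eval m y < mono_eval n y"
proof -
  define B where "B = (\<Sum>i\<in>UNIV. real (snd m i) + real (snd n i))"
  \<comment> \<open>The \<open>1\<close> keeps the divisor positive when both monomials are
    constant, and makes the final estimate strict.\<close>
  define C where "C = B + 1"
  have "B \<ge> 0"
    unfolding B_def by (intro sum_nonneg) simp
  then have C: "C > 0"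
    by (simp add: C_def)
  define D where "D = lg (mono_eval n x) - lg (mono_eval m x)"
  have "D > 0"
    unfolding D_def using assms by (simp add: lg_less_iff)
  have "mono_eval m y < mono_eval n y" if y: "near (D / C) x y" for y
  proof -
    have "\<bar>(\<Sum>i\<in>UNIV. (real (snd n i) - real (snd m i)) * (lg (y i) - lg (x i)))\<bar>
      \<le> (\<Sum>i\<in>UNIV. (real (snd m i) + real (snd n i)) * (D / C))"
    proof (rule order_trans[OF sum_abs] sum_mono)+
      fix i
      have "\<bar>lg (y i) - lg (x i)\<bar> \<le> D / C"
        using y by (auto simp: near_def less_imp_le)
      then show "\<bar>(real (snd n i) - real (snd m i)) * (lg (y i) - lg (x i))\<bar>
          \<le> (real (snd m i) + real (snd n i)) * (D / C)"
        unfolding abs_mult by (intro mult_mono) auto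
    qed
    also have "\<dots> = B * (D / C)"
      unfolding B_def by (rule sum_distrib_right[symmetric])
    also have "\<dots> < D"
      using C \<open>D > 0\<close> by (simp add: C_def field_simps)
    finally have "- D < (\<Sum>i\<in>UNIV. (real (snd n i) - real (snd m i)) * (lg (y i) - lg (x i)))"
      by linarith
    then have "lg (mono_eval m y) < lg (mono_eval n y)"
      unfolding D_def lg_mono_eval by (simp add: algebra_simps sum.distrib sum_subtractf)
    then show ?thesis
      by (simp add: lg_less_iff)
  qed
  then show ?thesis
    using C \<open>D > 0\<close> by (intro exI[of _ "D / C"]) simp
qed

lemma near_poly_eval_eq_mono_eval:
  fixes x :: "'n::finite \<Rightarrow> 'a::complete_arch_div_semifield"
  assumes "m \<in> set p" "\<And>k. k \<in> set p \<Longrightarrow> k \<noteq> m \<Longrightarrow> mono_eval k x < mono_eval m x"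
  shows "\<exists>e>0. \<forall>y. near e x y \<longrightarrow> poly_eval p y = mono_eval m y"
proof -
  have "\<exists>e>0. \<forall>k\<in>set p. k \<noteq> m \<longrightarrow> (\<forall>y. near e x y \<longrightarrow> mono_eval k y < mono_eval m y)"
    using assms(2) near_less[of _ x m]
    by (intro finite_ex_common_pos) (auto dest: near_mono, meson zero_less_one)
  then obtain e where "e > 0"
    and "\<And>k y. k \<in> set p \<Longrightarrow> k \<noteq> m \<Longrightarrow> near e x y \<Longrightarrow> mono_eval k y < mono_eval m y"
    by blast
  then show ?thesis
    using assms(1) by (intro exI[of _ e]) (metis poly_eval_eqI order.refl less_imp_le)
qed

lemma lg_mono_eval_fun_upd:
  fixes x :: "'n::finite \<Rightarrow> 'a::complete_arch_div_semifield"
  shows "lg (mono_eval m (x(i := x i * t))) = lg (mono_eval m x) + real (snd m i) * lg t"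
proof -
  have "(\<Sum>j\<in>UNIV. real (snd m j) * lg ((x(i := x i * t)) j)) =
      (\<Sum>j\<in>UNIV. real (snd m j) * lg (x j) + (if j = i then real (snd m i) * lg t else 0))"
    by (intro sum.cong) (auto simp: lg_mult algebra_simps)
  then show ?thesis
    by (simp add: lg_mono_eval sum.distrib)
qed

lemma near_fun_upd: "\<bar>lg t\<bar> < e \<Longrightarrow> near e x (x(i := x i * t))"
  by (auto simp: near_def lg_mult)

text \<open>
  Near a point that is no corner root a polynomial is a single monomial, so a monomial below it that
  touches it there has the same slopes.
\<close>

lemma corner_root_if_touching:
  fixes x :: "'n::finite \<Rightarrow> 'a::complete_arch_div_semifield"
  assumes b: "1 < (b::'a)" and p: "p \<noteq> []"
    and u: "\<And>y. mono_eval u y \<le> poly_eval p y" "mono_eval u x = poly_eval p x"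
    and v: "\<And>y. mono_eval v y \<le> poly_eval p y" "mono_eval v x = poly_eval p x"
    and uv: "snd u \<noteq> snd v"
  shows "corner_root p x"
proof (rule ccontr)
  assume no: "\<not> corner_root p x"
  obtain m where m: "m \<in> set p" "poly_eval p x = mono_eval m x"
    using p by (rule poly_eval_attained)
  have "mono_eval k x < mono_eval m x" if "k \<in> set p" "k \<noteq> m" for k
    using no m that mono_eval_le_poly_eval[OF that(1), of x] unfolding corner_root_def
    by (metis order.not_eq_order_implies_strict)
  then obtain e where e: "e > 0" "\<And>y. near e x y \<Longrightarrow> poly_eval p y = mono_eval m y"
    using near_poly_eval_eq_mono_eval[OF m(1)] by blast
  obtain t :: 'a where t: "0 < lg t" "lg t < e"
    using ex_small_lg[OF b e(1)] by blast
  have slopes: "snd w i = snd m i"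
    if w: "\<And>y. mono_eval w y \<le> poly_eval p y" "mono_eval w x = poly_eval p x" for w i
  proof -
    have le: "real (snd w i) * lg s \<le> real (snd m i) * lg s" if s: "\<bar>lg s\<bar> < e" for s :: 'a
    proof -
      have "mono_eval w (x(i := x i * s)) \<le> mono_eval m (x(i := x i * s))"
        using w(1) e(2)[OF near_fun_upd[OF s]] by metis
      then show ?thesis
        using w(2) m(2) by (simp add: lg_mono_eval_fun_upd flip: lg_le_iff)
    qed
    \<comment> \<open>Moving up by \<open>t\<close> and down by \<open>inverse t\<close> gives the
      two opposite inequalities between the exponents.\<close>
    show ?thesis
      using le[of t] le[of "inverse t"] t by (simp add: lg_inverse)
  qed
  have "snd u = snd m" "snd v = snd m"
    by (intro ext slopes u v)+
  then show False
    using uv by simp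
qed

text \<open>Cancelling a factor creates no new corner roots. Multiplying \<open>u\<close> and
  \<open>v\<close> by a monomial that attains \<open>d\<close> at \<open>x\<close> gives two
  monomials with different exponents that lie below \<open>p\<close> and touch it at
  \<open>x\<close>. They need not occur in the list \<open>p\<close>, hence the appeal to
  \<open>corner_root_if_touching\<close>.\<close>

lemma corner_root_mult:
  fixes x :: "'n::finite \<Rightarrow> 'a::complete_arch_div_semifield"
  assumes b: "1 < (b::'a)" and pq: "is_poly p" "is_poly q"
    and d: "d \<in> poly_funs" "poly_eval p = d * poly_eval q" and x: "corner_root q x"
  shows "corner_root p x"
proof -
  obtain u v where u: "u \<in> set q" "mono_eval u x = poly_eval q x"
    and v: "v \<in> set q" "mono_eval v x = poly_eval q x" and "u \<noteq> v"
    using x by (auto simp: corner_root_def)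
  then have uv: "snd u \<noteq> snd v"
    using pq(2) by (auto simp: is_poly_def distinct_map inj_on_def)
  obtain l where l: "d = poly_eval l" "l \<noteq> []"
    using d(1) by (rule poly_funsE)
  obtain e where e: "e \<in> set l" "d x = mono_eval e x"
    using poly_eval_attained[OF l(2)] l(1) by metis
  have le: "mono_eval (mono_mult e w) y \<le> poly_eval p y" if "w \<in> set q" for w y
    unfolding mono_eval_mult d(2) l(1) times_fun_apply
    by (intro semifield_mult_mono mono_eval_le_poly_eval e that)
  have "snd (mono_mult e u) \<noteq> snd (mono_mult e v)"
    using uv by (auto simp: mono_mult_def fun_eq_iff)
  then show ?thesis
    using pq(1) u v e(2)
    by (intro corner_root_if_touching[OF b _ le[OF u(1)] _ le[OF v(1)]])
      (auto simp: is_poly_def mono_eval_mult d(2))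
qed

section \<open>Reduced fractions\<close>

definition mono_degree :: "('n::finite, 'a) monomial \<Rightarrow> nat" where
  "mono_degree m = (\<Sum>i\<in>UNIV. snd m i)"

definition poly_degree :: "('n::finite, 'a) monomial list \<Rightarrow> nat" where
  "poly_degree p = Max (mono_degree ` set p)"

lemma mono_degree_le: "m \<in> set p \<Longrightarrow> mono_degree m \<le> poly_degree p"
  by (simp add: poly_degree_def)

lemma poly_degree_attained:
  assumes "p \<noteq> []"
  obtains m where "m \<in> set p" "mono_degree m = poly_degree p"
proof -
  have "poly_degree p \<in> mono_degree ` set p"
    unfolding poly_degree_def using assms by (intro Max_in) auto
  then show ?thesis
    using that by auto
qed

lemma lg_mono_eval_diag: "lg (mono_eval m (\<lambda>_. t)) = lg (fst m) + real (mono_degree m) * lg t"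
  by (simp add: lg_mono_eval mono_degree_def sum_distrib_right)

text \<open>Along the diagonal, in logarithms, \<open>p\<close> grows at most with slope
  \<open>poly_degree p\<close>, whereas the product of top-degree monomials of \<open>q\<close> and
  \<open>r\<close> grows with the sum of their degrees.\<close>

lemma poly_degree_mult_ge:
  fixes p q r :: "('n::finite, 'a::complete_arch_div_semifield) monomial list"
  assumes b: "1 < (b::'a)" and ne: "p \<noteq> []" "q \<noteq> []" "r \<noteq> []"
    and eq: "poly_eval p = poly_eval q * poly_eval r"
  shows "poly_degree q + poly_degree r \<le> poly_degree p"
proof (rule ccontr)
  assume "\<not> ?thesis"
  then have deg: "real (poly_degree p) + 1 \<le> real (poly_degree q) + real (poly_degree r)"
    by linarith
  obtain m where m: "m \<in> set q" "mono_degree m = poly_degree q"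
    using ne(2) by (rule poly_degree_attained)
  obtain n where n: "n \<in> set r" "mono_degree n = poly_degree r"
    using ne(3) by (rule poly_degree_attained)
  define C where "C = Max ((\<lambda>k. lg (fst k)) ` set p)"
  have lgb: "0 < lg b"
    using lg_strict_mono[OF b] by (simp add: lg_one)
  obtain N :: nat where "(C - lg (fst m) - lg (fst n)) / lg b < real N"
    using reals_Archimedean2 by blast
  then have N: "C - lg (fst m) - lg (fst n) < real N * lg b"
    using lgb by (simp add: field_simps)
  \<comment> \<open>A point so far out that its logarithm outweighs the coefficients
    involved.\<close>
  define t where "t = b ^ N"
  define T where "T = lg t"
  have T: "0 \<le> T" "C - lg (fst m) - lg (fst n) < T"
    using lgb N by (simp_all add: T_def t_def lg_power)
  obtain k where k: "k \<in> set p" "poly_eval p (\<lambda>_. t) = mono_eval k (\<lambda>_. t)"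
    using ne(1) by (rule poly_eval_attained)
  have "lg (mono_eval m (\<lambda>_. t)) + lg (mono_eval n (\<lambda>_. t)) \<le> lg (poly_eval p (\<lambda>_. t))"
    unfolding eq times_fun_apply lg_mult lg_le_iff
    using mono_eval_le_poly_eval[OF m(1)] mono_eval_le_poly_eval[OF n(1)]
    by (intro add_mono) (auto simp: lg_le_iff)
  also have "\<dots> = lg (fst k) + real (mono_degree k) * T"
    by (simp add: k(2) lg_mono_eval_diag T_def)
  also have "\<dots> \<le> C + real (poly_degree p) * T"
    using k(1) T(1) mono_degree_le[OF k(1)] unfolding C_def
    by (intro add_mono mult_right_mono Max_ge) auto
  also have "C + real (poly_degree p) * T + T \<le> C + (real (poly_degree q) + real (poly_degree r)) * T"
    using mult_right_mono[OF deg T(1)] by (simp add: algebra_simps)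
  finally show False
    using T by (simp add: lg_mono_eval_diag m n algebra_simps flip: T_def)
qed

lemma poly_fun_dvd_one_if_degree_zero:
  fixes p :: "('n::finite, 'a::bipotent_semifield) monomial list"
  assumes "p \<noteq> []" "poly_degree p = 0"
  shows "poly_fun_dvd (poly_eval p) 1"
proof -
  have "mono_eval m x = fst m" if "m \<in> set p" for m x
    using mono_degree_le[OF that] assms(2) by (simp add: mono_degree_def mono_eval_def)
  then have const: "poly_eval p x = Max (fst ` set p)" for x
    by (simp add: poly_eval_eq_Max[OF assms(1)])
  have "1 = poly_eval p * (\<lambda>_. inverse (Max (fst ` set p)))"
    by (simp add: fun_eq_iff const semifield_right_inverse)
  then show ?thesis
    unfolding poly_fun_dvd_def using const_in_poly_funs by blast
qed

text \<open>A common factor that is no unit has positive degree, so cancelling it lowers the degree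
  of the numerator. The factor \<open>d\<close> collects everything cancelled.\<close>

lemma ex_reduced_fraction:
  fixes h g :: "('n::finite, 'a::complete_arch_div_semifield) monomial list"
  assumes b: "1 < (b::'a)" and "is_poly h" "is_poly g"
  shows "\<exists>h' g' d. reduced_fraction h' g' \<and> d \<in> poly_funs \<and>
    poly_eval h = d * poly_eval h' \<and> poly_eval g = d * poly_eval g'"
  using assms(2,3)
proof (induction "poly_degree h" arbitrary: h g rule: less_induct)
  case less
  show ?case
  proof (cases "reduced_fraction h g")
    case True
    then show ?thesis
      using const_in_poly_funs[of 1]
      by (intro exI[of _ h] exI[of _ g] exI[of _ "\<lambda>_. 1"]) (simp add: fun_eq_iff)
  next
    case False
    then obtain d h1 g1 where d: "d \<in> poly_funs" "\<not> poly_fun_dvd d 1" and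
      "h1 \<in> poly_funs" "g1 \<in> poly_funs" and eq: "poly_eval h = d * h1" "poly_eval g = d * g1"
      using less.prems unfolding reduced_fraction_def poly_fun_dvd_def by blast
    then obtain l h2 g2 where l: "d = poly_eval l" "l \<noteq> []"
      and h2: "is_poly h2" "h1 = poly_eval h2" "h2 \<noteq> []"
      and g2: "is_poly g2" "g1 = poly_eval g2"
      by (metis poly_funsE)
    have "poly_degree l \<noteq> 0"
      using d(2) poly_fun_dvd_one_if_degree_zero[OF l(2)] by (auto simp: l(1))
    moreover have "poly_degree l + poly_degree h2 \<le> poly_degree h"
      using less.prems(1) l h2 eq by (intro poly_degree_mult_ge[OF b]) (auto simp: is_poly_def)
    ultimately have "poly_degree h2 < poly_degree h"
      by linarith
    from less.hyps[OF this h2(1) g2(1)] obtain h' g' d' where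
      *: "reduced_fraction h' g'" "d' \<in> poly_funs" "poly_eval h2 = d' * poly_eval h'"
        "poly_eval g2 = d' * poly_eval g'"
      by blast
    show ?thesis
      using * eq h2 g2 poly_funs_mult[OF d(1) *(2)]
      by (intro exI[of _ h'] exI[of _ g'] exI[of _ "d * d'"]) (simp add: mult.assoc)
  qed
qed

text \<open>Since \<open>G \<le> h\<close> everywhere, the condition at corner roots of the
  denominator is automatic. The one for the numerator survives reduction, because corner roots of
  \<open>h'\<close> are corner roots of \<open>h\<close>.\<close>

lemma ex_corner_integral_fraction:
  fixes h :: "('n::finite, 'a::complete_arch_div_semifield) monomial list"
  assumes b: "1 < (b::'a)" and h: "is_poly h" and G: "G \<in> poly_funs"
    and le: "\<And>x. G x \<le> poly_eval h x"
    and cr: "\<And>x. corner_root h x \<Longrightarrow> poly_eval h x \<le> G x"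
  shows "\<exists>h' g'. reduced_fraction h' g' \<and> corner_integral h' g' \<and>
    poly_eval h' / poly_eval g' = poly_eval h / G"
proof -
  obtain g where g: "is_poly g" "G = poly_eval g"
    using G by (rule poly_funsE)
  obtain h' g' d where *: "reduced_fraction h' g'" "d \<in> poly_funs"
    "poly_eval h = d * poly_eval h'" "poly_eval g = d * poly_eval g'"
    using ex_reduced_fraction[OF b h g(1)] by blast
  have "is_poly h'" "is_poly g'"
    using *(1) by (auto simp: reduced_fraction_def)
  have "poly_eval h' x \<le> poly_eval g' x" if "corner_root h' x" for x
  proof -
    have "poly_eval h x \<le> poly_eval g x"
      using cr corner_root_mult[OF b h \<open>is_poly h'\<close> *(2,3) that] g(2) by simp
    then show ?thesis
      by (simp add: *(3,4) semifield_mult_le_cancel_left)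
  qed
  moreover have "poly_eval g' x \<le> poly_eval h' x" for x
    using le[of x] unfolding g(2) by (simp add: *(3,4) semifield_mult_le_cancel_left)
  moreover have "poly_eval h' / poly_eval g' = poly_eval h / G"
    unfolding g(2) *(3,4) by (simp add: fun_eq_iff lg_simps flip: lg_eq_iff)
  ultimately show ?thesis
    using *(1) by (auto simp: corner_integral_def)
qed

section \<open>Regularity\<close>

text \<open>Containment in finitely many tropical hyperplanes, some possibly empty. Applied to the
  set where \<open>h\<close> and \<open>g\<close> agree, it expresses regularity without reference
  to the monomials of a fraction, and it is stable under subsets and finite unions.\<close>

definition thin :: "('n::finite \<Rightarrow> 'a::semifield) set \<Rightarrow> bool" where
  "thin Z \<longleftrightarrow> (\<exists>P. finite P \<and> (\<forall>(m, n)\<in>P. m \<noteq> n) \<and>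
     Z \<subseteq> {x. \<exists>(m, n)\<in>P. mono_eval m x = mono_eval n x})"

lemma thin_mono_eval_eq: "m \<noteq> n \<Longrightarrow> thin {x. mono_eval m x = mono_eval n x}"
  unfolding thin_def by (rule exI[of _ "{(m, n)}"]) auto

lemma thin_empty: "thin {}"
  unfolding thin_def by (rule exI[of _ "{}"]) auto

lemma thin_subset: "thin Z \<Longrightarrow> Y \<subseteq> Z \<Longrightarrow> thin Y"
  unfolding thin_def by (meson order_trans)

lemma thin_Un:
  assumes "thin Y" "thin Z"
  shows "thin (Y \<union> Z)"
proof -
  obtain P Q where "finite P" "\<forall>(m, n)\<in>P. m \<noteq> n" "Y \<subseteq> {x. \<exists>(m, n)\<in>P. mono_eval m x = mono_eval n x}"
    "finite Q" "\<forall>(m, n)\<in>Q. m \<noteq> n" "Z \<subseteq> {x. \<exists>(m, n)\<in>Q. mono_eval m x = mono_eval n x}"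
    using assms unfolding thin_def by blast
  then show ?thesis
    unfolding thin_def by (intro exI[of _ "P \<union> Q"] conjI) (simp, blast, blast)
qed

text \<open>The pairs are treated one after another. If the current point still lies on the
  hyperplane of \<open>m\<close> and \<open>n\<close>, one coordinate in which their exponents
  differ is changed slightly.\<close>

lemma ex_near_generic:
  fixes x :: "'n::finite \<Rightarrow> 'a::complete_arch_div_semifield"
  assumes b: "1 < (b::'a)" and "finite P" "\<forall>(m, n)\<in>P. m \<noteq> n" "e > 0"
  shows "\<exists>y. near e x y \<and> (\<forall>(m, n)\<in>P. mono_eval m y \<noteq> mono_eval n y)"
  using assms(2-4)
proof (induction P arbitrary: e rule: finite_induct)
  case empty
  then show ?case
    by (intro exI[of _ x]) (simp add: near_def)
next
  case (insert r P)
  obtain m n where r: "r = (m, n)" by (cases r)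
  have mn: "m \<noteq> n"
    using insert.prems by (auto simp: r)
  obtain y where y: "near (e/2) x y" "\<forall>(m, n)\<in>P. mono_eval m y \<noteq> mono_eval n y"
    using insert.IH[of "e/2"] insert.prems by auto
  show ?case
  proof (cases "mono_eval m y = mono_eval n y")
    case False
    then show ?thesis
      using y near_mono[OF y(1), of e] insert.prems(2) by (auto simp: r)
  next
    case True
    have "snd m \<noteq> snd n"
    proof
      assume "snd m = snd n"
      then have "lg (fst m) = lg (fst n)"
        using arg_cong[OF True, of lg] by (simp add: lg_mono_eval)
      then show False
        using mn \<open>snd m = snd n\<close> by (simp add: lg_eq_iff prod_eq_iff)
    qed
    then obtain i where i: "snd m i \<noteq> snd n i"
      by auto
    \<comment> \<open>The inequalities already achieved are open conditions, so a small enough move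
      preserves all of them.\<close>
    have "\<exists>d>0. \<forall>s\<in>P. \<forall>z. near d y z \<longrightarrow> mono_eval (fst s) z \<noteq> mono_eval (snd s) z"
    proof (rule finite_ex_common_pos[OF insert.hyps(1)])
      fix s assume "s \<in> P"
      then have "mono_eval (fst s) y \<noteq> mono_eval (snd s) y"
        using y(2) by (auto simp: case_prod_beta)
      then consider "mono_eval (fst s) y < mono_eval (snd s) y" | "mono_eval (snd s) y < mono_eval (fst s) y"
        by (metis linorder_neqE)
      then show "\<exists>d>0. \<forall>z. near d y z \<longrightarrow> mono_eval (fst s) z \<noteq> mono_eval (snd s) z"
        by cases (metis near_less order.irrefl)+
    qed (meson near_mono)
    then obtain d where d: "d > 0"
      "\<And>s z. s \<in> P \<Longrightarrow> near d y z \<Longrightarrow> mono_eval (fst s) z \<noteq> mono_eval (snd s) z"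
      by blast
    obtain t :: 'a where t: "0 < lg t" "lg t < min d (e/2)"
      using ex_small_lg[OF b, of "min d (e/2)"] d(1) insert.prems(2) by auto
    let ?z = "y(i := y i * t)"
    have "near (e/2) y ?z" "near d y ?z"
      using t by (auto intro!: near_fun_upd)
    have "\<bar>lg (?z j) - lg (x j)\<bar> < e" for j
    proof -
      have "\<bar>lg (y j) - lg (x j)\<bar> < e/2" "\<bar>lg (?z j) - lg (y j)\<bar> < e/2"
        using y(1) \<open>near (e/2) y ?z\<close> unfolding near_def by blast+
      then show ?thesis
        by linarith
    qed
    then have "near e x ?z"
      unfolding near_def by blast
    moreover have "mono_eval m ?z \<noteq> mono_eval n ?z"
      using i t(1) True by (simp add: lg_mono_eval_fun_upd flip: lg_eq_iff)
    moreover have "\<forall>(m, n)\<in>P. mono_eval m ?z \<noteq> mono_eval n ?z"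
      using d(2)[OF _ \<open>near d y ?z\<close>] by auto
    ultimately show ?thesis
      by (intro exI[of _ ?z]) (simp add: r del: fun_upd_apply)
  qed
qed

text \<open>Where regularity fails, one common monomial is the strict maximum of both
  \<open>h\<close> and \<open>g\<close>. Then \<open>h\<close> and \<open>g\<close> agree on a whole
  ball, which contains a point off the hyperplanes that cover a thin set.\<close>

lemma regular_if_thin:
  fixes h g :: "('n::finite, 'a::complete_arch_div_semifield) monomial list"
  assumes b: "1 < (b::'a)" and hg: "h \<noteq> []" "g \<noteq> []"
    and thin: "thin {x. poly_eval h x = poly_eval g x}"
  shows "regular h g"
proof (rule ccontr)
  assume "\<not> regular h g"
  then obtain x where x: "\<And>m m'. m \<in> set h \<Longrightarrow> m' \<in> set g \<Longrightarrow> poly_eval h x = mono_eval m x \<Longrightarrow>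
      poly_eval g x = mono_eval m' x \<Longrightarrow> m = m'"
    unfolding regular_def by blast
  obtain m where m: "m \<in> set h" "poly_eval h x = mono_eval m x"
    using hg(1) by (rule poly_eval_attained)
  obtain m' where m': "m' \<in> set g" "poly_eval g x = mono_eval m' x"
    using hg(2) by (rule poly_eval_attained)
  have [simp]: "m' = m"
    using x m m' by metis
  have "mono_eval k x < mono_eval m x" if "k \<in> set h" "k \<noteq> m" for k
    using x m m' that mono_eval_le_poly_eval[OF that(1), of x]
    by (metis \<open>m' = m\<close> order.not_eq_order_implies_strict)
  from near_poly_eval_eq_mono_eval[OF m(1) this]
  obtain d where d: "d > 0" "\<And>y. near d x y \<Longrightarrow> poly_eval h y = mono_eval m y"
    by blast
  have m'g: "m \<in> set g"
    using m'(1) by simp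
  have "mono_eval k x < mono_eval m x" if "k \<in> set g" "k \<noteq> m" for k
    using x m m' that mono_eval_le_poly_eval[OF that(1), of x]
    by (metis \<open>m' = m\<close> order.not_eq_order_implies_strict)
  from near_poly_eval_eq_mono_eval[OF m'g this]
  obtain e where e: "e > 0" "\<And>y. near e x y \<Longrightarrow> poly_eval g y = mono_eval m y"
    by blast
  obtain P where P: "finite P" "\<forall>(m, n)\<in>P. m \<noteq> n"
    "{x. poly_eval h x = poly_eval g x} \<subseteq> {x. \<exists>(m, n)\<in>P. mono_eval m x = mono_eval n x}"
    using thin unfolding thin_def by blast
  obtain y where y: "near (min d e) x y" "\<forall>(m, n)\<in>P. mono_eval m y \<noteq> mono_eval n y"
    using ex_near_generic[OF b P(1,2), of "min d e" x] d(1) e(1) by auto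
  have "poly_eval h y = poly_eval g y"
    using d(2) e(2) near_mono[OF y(1)] by simp
  then show False
    using P(3) y(2) by fastforce
qed

lemma thin_if_regular:
  assumes "regular h g"
  shows "thin {x. poly_eval h x = poly_eval g x}"
proof -
  let ?P = "{(m, n). (m, n) \<in> set h \<times> set g \<and> m \<noteq> n}"
  have "finite ?P"
    by (rule finite_subset[of _ "set h \<times> set g"]) auto
  moreover have "{x. poly_eval h x = poly_eval g x} \<subseteq> {x. \<exists>(m, n)\<in>?P. mono_eval m x = mono_eval n x}"
  proof
    fix x assume x: "x \<in> {x. poly_eval h x = poly_eval g x}"
    obtain m n where "m \<in> set h" "n \<in> set g" "poly_eval h x = mono_eval m x"
      "poly_eval g x = mono_eval n x" "m \<noteq> n"
      using assms unfolding regular_def by blast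
    then show "x \<in> {x. \<exists>(m, n)\<in>?P. mono_eval m x = mono_eval n x}"
      using x by (intro CollectI bexI[of _ "(m, n)"]) auto
  qed
  ultimately show ?thesis
    unfolding thin_def by (intro exI[of _ ?P]) auto
qed

section \<open>Bounded rational functions\<close>

text \<open>The kernel generated by a constant other than \<open>1\<close>, described without
  choosing the constant; see \<open>kernel_gen_const\<close>.\<close>

definition bounded_rat_funs :: "(('n::finite \<Rightarrow> 'a::complete_arch_div_semifield) \<Rightarrow> 'a) set" where
  "bounded_rat_funs = {u \<in> rat_funs. \<exists>c. \<forall>x. \<bar>lg (u x)\<bar> \<le> c}"

lemma bounded_rat_funs_eq_lg_dom:
  fixes a :: "'a::complete_arch_div_semifield"
  assumes "a \<noteq> 1"
  shows "bounded_rat_funs = {u \<in> rat_funs :: (('n::finite \<Rightarrow> 'a) \<Rightarrow> 'a) set. lg_dom u (\<lambda>_. a)}"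
proof -
  have "0 < \<bar>lg a\<bar>"
    using assms by (simp add: lg_eq_0_iff)
  then have "lg_dom u (\<lambda>_. a)" if "\<forall>x. \<bar>lg (u x)\<bar> \<le> c" for u c
    using that by (intro lg_domI[of _ "c / \<bar>lg a\<bar>"]) simp
  then show ?thesis
    unfolding bounded_rat_funs_def by (auto simp: lg_dom_def)
qed

lemma const_in_rat_funs: "(\<lambda>_. c :: 'a::complete_arch_div_semifield) \<in> rat_funs"
proof -
  have "(\<lambda>_. c) = (\<lambda>_. c) / (\<lambda>_. 1)"
    by (simp add: fun_eq_iff lg_simps flip: lg_eq_iff)
  then show ?thesis
    by (metis const_in_poly_funs rat_funs_divide)
qed

lemma kernel_gen_const:
  fixes a :: "'a::complete_arch_div_semifield"
  assumes "a \<noteq> 1"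
  shows "kernel_gen rat_funs (\<lambda>_. a) =
    (bounded_rat_funs :: (('n::finite \<Rightarrow> 'a) \<Rightarrow> 'a) set)"
  unfolding bounded_rat_funs_eq_lg_dom[OF assms]
  by (rule kernel_gen_eq[OF subsemifield_rat_funs const_in_rat_funs])

lemma subsemifield_bounded_rat_funs:
  assumes "(b::'a::complete_arch_div_semifield) \<noteq> 1"
  shows "subsemifield (bounded_rat_funs :: (('n::finite \<Rightarrow> 'a) \<Rightarrow> 'a) set)"
  unfolding bounded_rat_funs_eq_lg_dom[OF assms]
  by (rule subsemifield_lg_dom[OF subsemifield_rat_funs])

section \<open>Generating the lattice\<close>

text \<open>With nonnegative logarithms absolute values disappear, so that the product of two such
  functions generates the product of their kernels.\<close>

definition lattice_elem ::
    "(('n::finite \<Rightarrow> 'a::complete_arch_div_semifield) \<Rightarrow> 'a) set set \<Rightarrow> (('n \<Rightarrow> 'a) \<Rightarrow> 'a) \<Rightarrow> bool" where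
  "lattice_elem G f \<longleftrightarrow> f \<in> bounded_rat_funs \<and> (\<forall>x. 0 \<le> lg (f x)) \<and>
     kernel_gen bounded_rat_funs f \<in> lattice_generated G"

lemma lattice_elem_mult:
  assumes b: "(b::'a::complete_arch_div_semifield) \<noteq> 1"
    and f: "lattice_elem G f" and g: "lattice_elem G (g :: ('n::finite \<Rightarrow> 'a) \<Rightarrow> 'a)"
  shows "lattice_elem G (f * g)"
proof -
  note S = subsemifield_bounded_rat_funs[OF b, where 'n = 'n]
  have "f + inverse f = f" "g + inverse g = g"
    using f g by (simp_all add: lattice_elem_def fun_eq_iff lg_simps max_absorb1 flip: lg_eq_iff)
  then have "kernel_gen bounded_rat_funs (f * g) =
      kernel_gen bounded_rat_funs f * kernel_gen bounded_rat_funs g"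
    using kernel_gen_times[OF S, of f g] f g by (simp add: lattice_elem_def)
  then show ?thesis
    using f g by (auto simp: lattice_elem_def lg_simps intro: subsemifieldD[OF S] lattice_generated.prod)
qed

text \<open>The factor \<open>f\<close> covers the empty product, since the trivial kernel is not
  assumed to be in the generated lattice.\<close>

lemma lattice_elem_mult_prod:
  assumes b: "(b::'a::complete_arch_div_semifield) \<noteq> 1" and "finite A"
    and f: "lattice_elem G f"
    and g: "\<And>k. k \<in> A \<Longrightarrow> lattice_elem G (g k :: ('n::finite \<Rightarrow> 'a) \<Rightarrow> 'a)"
  shows "lattice_elem G (f * (\<Prod>k\<in>A. g k))"
  using assms(2) g
proof (induction A rule: finite_induct)
  case empty
  then show ?case
    using f by simp
next
  case (insert k A)
  have "f * (\<Prod>k\<in>insert k A. g k) = g k * (f * (\<Prod>k\<in>A. g k))"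
    using insert.hyps by (simp add: mult_ac)
  moreover have "lattice_elem G (f * (\<Prod>k\<in>A. g k))"
    by (rule insert.IH) (rule insert.prems, simp)
  then have "lattice_elem G (g k * (f * (\<Prod>k\<in>A. g k)))"
    by (rule lattice_elem_mult[OF b insert.prems[OF insertI1]])
  ultimately show ?case
    by (simp only:)
qed

lemma lg_prod_fun_apply: "lg ((\<Prod>k\<in>A. g k) x) = (\<Sum>k\<in>A. lg (g k x))"
  by (induction A rule: infinite_finite_induct) (simp_all add: lg_mult lg_one)

lemma lattice_generated_INT:
  assumes "finite I" "I \<noteq> {}" "\<And>i. i \<in> I \<Longrightarrow> K i \<in> lattice_generated G"
  shows "(\<Inter>i\<in>I. K i) \<in> lattice_generated G"
  using assms by (induction I rule: finite_ne_induct) (auto intro: lattice_generated.inter)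

text \<open>
  In logarithms, \<open>T\<close> enforces \<open>k \<le> m\<close> on the set where \<open>m = n\<close>, up to the truncation at \<open>b\<close>.
\<close>

definition order_constraint ::
    "(('n::finite \<Rightarrow> 'a::complete_arch_div_semifield) \<Rightarrow> 'a) set set \<Rightarrow> 'a \<Rightarrow> ('n, 'a) monomial \<Rightarrow>
      ('n, 'a) monomial \<Rightarrow> ('n, 'a) monomial \<Rightarrow> (('n \<Rightarrow> 'a) \<Rightarrow> 'a) \<Rightarrow> bool" where
  "order_constraint G b m n k T \<longleftrightarrow> lattice_elem G T \<and>
     (\<exists>c\<ge>0. \<forall>x. mono_eval k x \<le> mono_eval m x \<longrightarrow>
       lg (T x) \<le> c * \<bar>lg (mono_eval m x) - lg (mono_eval n x)\<bar>) \<and>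
     (\<forall>x. \<bar>lg (mono_eval m x) - lg (mono_eval n x)\<bar> < lg b \<longrightarrow> lg (T x) < lg b \<longrightarrow>
       lg (mono_eval k x) \<le> lg (mono_eval m x) + lg (T x) +
         \<bar>lg (mono_eval m x) - lg (mono_eval n x)\<bar>)"

text \<open>The function \<open>F\<close> multiplies \<open>D\<close> by all order constraints. On
  the cell of \<open>m\<close> and \<open>n\<close> one has \<open>f = m / n\<close>, and every
  factor is controlled by the distance between \<open>m\<close> and \<open>n\<close>. Everywhere,
  \<open>F\<close> dominates \<open>f\<close>: by the constraints where \<open>F < b\<close>, by
  boundedness of \<open>f\<close> elsewhere.\<close>

lemma ex_cell_elem:
  fixes h g :: "('n::finite, 'a::complete_arch_div_semifield) monomial list"
  assumes b: "1 < b" and m: "m \<in> set h" and n: "n \<in> set g"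
    and f: "poly_eval h / poly_eval g \<in> bounded_rat_funs"
    and D: "lattice_elem G D"
      "\<And>x. lg (D x) = min \<bar>lg (mono_eval m x) - lg (mono_eval n x)\<bar> (lg b)"
    and T: "\<And>k. k \<in> set h \<Longrightarrow> order_constraint G b m n k (T k)"
    and U: "\<And>k. k \<in> set g \<Longrightarrow> order_constraint G b n m k (U k)"
  shows "\<exists>F c. lattice_elem G F \<and> lg_dom (poly_eval h / poly_eval g) F \<and> c \<ge> 0 \<and>
    (\<forall>x. poly_eval h x = mono_eval m x \<longrightarrow> poly_eval g x = mono_eval n x \<longrightarrow>
       lg (F x) \<le> c * \<bar>lg ((poly_eval h / poly_eval g) x)\<bar>)"
proof -
  have b1: "b \<noteq> 1" and lgb: "0 < lg b"
    using b lg_strict_mono[OF b] by (auto simp: lg_one)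
  let ?f = "poly_eval h / poly_eval g"
  let ?d = "\<lambda>x. \<bar>lg (mono_eval m x) - lg (mono_eval n x)\<bar>"
  define F where "F = D * (\<Prod>k\<in>set h. T k) * (\<Prod>k\<in>set g. U k)"
  have F: "lattice_elem G F"
    unfolding F_def using T U
    by (intro lattice_elem_mult_prod[OF b1] D(1)) (auto simp: order_constraint_def)
  have lgF: "lg (F x) = lg (D x) + (\<Sum>k\<in>set h. lg (T k x)) + (\<Sum>k\<in>set g. lg (U k x))" for x
    by (simp add: F_def lg_mult lg_prod_fun_apply)
  have T0: "0 \<le> lg (T k x)" if "k \<in> set h" for k x
    using T[OF that] by (simp add: order_constraint_def lattice_elem_def)
  have U0: "0 \<le> lg (U k x)" if "k \<in> set g" for k x
    using U[OF that] by (simp add: order_constraint_def lattice_elem_def)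
  have D0: "0 \<le> lg (D x)" for x
    using D(1) by (simp add: lattice_elem_def)
  have sT: "0 \<le> (\<Sum>k\<in>set h. lg (T k x))" and sU: "0 \<le> (\<Sum>k\<in>set g. lg (U k x))" for x
    by (auto intro!: sum_nonneg T0 U0)
  have TF: "lg (T k x) \<le> lg (F x)" if "k \<in> set h" for k x
    using member_le_sum[of k "set h" "\<lambda>k. lg (T k x)"] that T0 D0[of x] sU[of x] by (simp add: lgF)
  have UF: "lg (U k x) \<le> lg (F x)" if "k \<in> set g" for k x
    using member_le_sum[of k "set g" "\<lambda>k. lg (U k x)"] that U0 D0[of x] sT[of x] by (simp add: lgF)
  have DF: "lg (D x) \<le> lg (F x)" for x
    using sT[of x] sU[of x] by (simp add: lgF)
  obtain c where c: "\<And>x. \<bar>lg (?f x)\<bar> \<le> c"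
    using f by (auto simp: bounded_rat_funs_def)
  have c0: "0 \<le> c"
    \<comment> \<open>Any point shows that the bound is nonnegative.\<close>
    using c[of undefined] by linarith
  \<comment> \<open>Below \<open>b\<close> no factor is truncated. The maximum of \<open>h\<close>
    exceeds \<open>m\<close>, and that of \<open>g\<close> exceeds \<open>n\<close>, by at most a
    constraint plus the distance; the distance between \<open>m\<close> and \<open>n\<close> itself
    is the third term.\<close>
  have small: "\<bar>lg (?f x)\<bar> \<le> 3 * lg (F x)" if x: "lg (F x) < lg b" for x
  proof -
    have d: "?d x \<le> lg (F x)"
      using DF[of x] x by (simp add: D(2) min_def split: if_splits)
    obtain k where k: "k \<in> set h" "poly_eval h x = mono_eval k x"
      using m poly_eval_attained[of h x] by (metis empty_iff empty_set)
    obtain l where l: "l \<in> set g" "poly_eval g x = mono_eval l x"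
      using n poly_eval_attained[of g x] by (metis empty_iff empty_set)
    have "?d x < lg b" "lg (T k x) < lg b" "lg (U l x) < lg b"
      using d x TF[OF k(1), of x] UF[OF l(1), of x] by linarith+
    then have "lg (poly_eval h x) \<le> lg (mono_eval m x) + lg (T k x) + ?d x"
      "lg (poly_eval g x) \<le> lg (mono_eval n x) + lg (U l x) + ?d x"
      using T[OF k(1)] U[OF l(1)] unfolding order_constraint_def k(2) l(2)
      by (metis abs_minus_commute)+
    moreover have "lg (mono_eval m x) \<le> lg (poly_eval h x)" "lg (mono_eval n x) \<le> lg (poly_eval g x)"
      using m n by (simp_all add: lg_le_iff mono_eval_le_poly_eval)
    ultimately show ?thesis
      using d TF[OF k(1), of x] UF[OF l(1), of x] by (simp add: lg_divide)
  qed
  have "\<bar>lg (?f x)\<bar> \<le> (3 + c / lg b) * \<bar>lg (F x)\<bar>" for x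
  proof (cases "lg (F x) < lg b")
    case True
    have "0 \<le> lg (F x)"
      using D0[of x] DF[of x] by linarith
    moreover have "0 \<le> c / lg b * lg (F x)"
      using c0 lgb \<open>0 \<le> lg (F x)\<close> by simp
    ultimately show ?thesis
      using small[OF True] by (simp add: distrib_right)
  next
    case False
    then have "c * lg b \<le> c * lg (F x)" "0 < lg (F x)"
      using c0 lgb by (auto intro: mult_left_mono)
    then have "c \<le> c / lg b * lg (F x)"
      using lgb by (simp add: field_simps)
    then show ?thesis
      using c[of x] \<open>0 < lg (F x)\<close> by (simp add: distrib_right)
  qed
  then have dom: "lg_dom ?f F"
    by (rule lg_domI)
  obtain cT where cT: "\<And>k. k \<in> set h \<Longrightarrow> 0 \<le> cT k"
    "\<And>k x. k \<in> set h \<Longrightarrow> mono_eval k x \<le> mono_eval m x \<Longrightarrow> lg (T k x) \<le> cT k * ?d x"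
    using T unfolding order_constraint_def by metis
  obtain cU where cU: "\<And>k. k \<in> set g \<Longrightarrow> 0 \<le> cU k"
    "\<And>k x. k \<in> set g \<Longrightarrow> mono_eval k x \<le> mono_eval n x \<Longrightarrow> lg (U k x) \<le> cU k * ?d x"
    using U unfolding order_constraint_def by (metis abs_minus_commute)
  let ?c = "1 + (\<Sum>k\<in>set h. cT k) + (\<Sum>k\<in>set g. cU k)"
  have "lg (F x) \<le> ?c * \<bar>lg (?f x)\<bar>"
    if "poly_eval h x = mono_eval m x" "poly_eval g x = mono_eval n x" for x
  proof -
    have f: "\<bar>lg (?f x)\<bar> = ?d x"
      by (simp add: that lg_divide)
    have "(\<Sum>k\<in>set h. lg (T k x)) \<le> (\<Sum>k\<in>set h. cT k * ?d x)"
      using that mono_eval_le_poly_eval[of _ h x] by (intro sum_mono cT) auto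
    moreover have "(\<Sum>k\<in>set g. lg (U k x)) \<le> (\<Sum>k\<in>set g. cU k * ?d x)"
      using that mono_eval_le_poly_eval[of _ g x] by (intro sum_mono cU) auto
    moreover have "lg (D x) \<le> ?d x"
      by (simp add: D(2))
    ultimately show ?thesis
      unfolding lgF f by (simp add: distrib_right sum_distrib_right)
  qed
  moreover have "0 \<le> ?c"
    by (simp add: add_nonneg_nonneg sum_nonneg cT cU)
  ultimately show ?thesis
    using F dom by blast
qed

text \<open>At each point some \<open>F i\<close> is bounded by a multiple of \<open>f\<close>, so a
  function dominated by every \<open>F i\<close> is dominated by \<open>f\<close> there. Summing the
  factors over the finite set \<open>I\<close> makes the bound uniform.\<close>

lemma kernel_gen_eq_INT_cells:
  fixes f :: "('n::finite \<Rightarrow> 'a::complete_arch_div_semifield) \<Rightarrow> 'a"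
  assumes b: "(b::'a) \<noteq> 1" and f: "f \<in> bounded_rat_funs" and I: "finite I" "I \<noteq> {}"
    and F: "\<And>i. i \<in> I \<Longrightarrow> lattice_elem G (F i)" "\<And>i. i \<in> I \<Longrightarrow> lg_dom f (F i)"
    and c: "\<And>i. i \<in> I \<Longrightarrow> c i \<ge> 0" "\<And>x. \<exists>i\<in>I. lg (F i x) \<le> c i * \<bar>lg (f x)\<bar>"
  shows "kernel_gen bounded_rat_funs f \<in> lattice_generated G"
proof -
  note S = subsemifield_bounded_rat_funs[OF b, where 'n = 'n]
  let ?K = "kernel_gen (bounded_rat_funs :: (('n \<Rightarrow> 'a) \<Rightarrow> 'a) set)"
  have K: "?K (F i) = {u \<in> bounded_rat_funs. lg_dom u (F i)}" if "i \<in> I" for i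
    using F(1)[OF that] by (intro kernel_gen_eq[OF S]) (simp add: lattice_elem_def)
  have "?K f = (\<Inter>i\<in>I. ?K (F i))"
  proof (intro equalityI subsetI)
    fix u assume "u \<in> ?K f"
    then show "u \<in> (\<Inter>i\<in>I. ?K (F i))"
      unfolding kernel_gen_eq[OF S f] using lg_dom_trans[OF _ F(2)] by (simp add: K)
  next
    fix u assume "u \<in> (\<Inter>i\<in>I. ?K (F i))"
    then have u: "u \<in> bounded_rat_funs" "\<And>i. i \<in> I \<Longrightarrow> lg_dom u (F i)"
      using I(2) K by auto
    then obtain N where N: "\<And>i x. i \<in> I \<Longrightarrow> \<bar>lg (u x)\<bar> \<le> real (N i) * \<bar>lg (F i x)\<bar>"
      unfolding lg_dom_def by metis
    have "\<bar>lg (u x)\<bar> \<le> (\<Sum>i\<in>I. real (N i) * c i) * \<bar>lg (f x)\<bar>" for x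
    proof -
      obtain i where i: "i \<in> I" "lg (F i x) \<le> c i * \<bar>lg (f x)\<bar>"
        using c(2) by blast
      have "\<bar>lg (u x)\<bar> \<le> real (N i) * lg (F i x)"
        using N[OF i(1), of x] F(1)[OF i(1)] by (simp add: lattice_elem_def)
      also have "\<dots> \<le> real (N i) * (c i * \<bar>lg (f x)\<bar>)"
        by (intro mult_left_mono i(2)) simp
      also have "\<dots> \<le> (\<Sum>i\<in>I. real (N i) * c i) * \<bar>lg (f x)\<bar>"
        unfolding mult.assoc[symmetric] using I(1) i(1) c(1)
        by (intro mult_right_mono member_le_sum) auto
      finally show ?thesis .
    qed
    then have "lg_dom u f"
      by (rule lg_domI)
    then show "u \<in> ?K f"
      unfolding kernel_gen_eq[OF S f] using u(1) by simp
  qed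
  moreover have "(\<Inter>i\<in>I. ?K (F i)) \<in> lattice_generated G"
    using F(1) by (intro lattice_generated_INT I) (auto simp: lattice_elem_def)
  ultimately show ?thesis
    by simp
qed

text \<open>The set \<open>I\<close> selects the cells used, which must cover all points: all pairs
  of monomials in the general case, only pairs with \<open>m \<noteq> n\<close> in the regular
  case.\<close>

lemma kernel_gen_in_lattice_generated:
  fixes h g :: "('n::finite, 'a::complete_arch_div_semifield) monomial list"
  assumes b: "1 < b" and f: "poly_eval h / poly_eval g \<in> bounded_rat_funs"
    and I: "I \<subseteq> set h \<times> set g"
      "\<And>x. \<exists>(m, n)\<in>I. poly_eval h x = mono_eval m x \<and> poly_eval g x = mono_eval n x"
    and D: "\<And>m n. (m, n) \<in> I \<Longrightarrow> \<exists>D. lattice_elem G D \<and>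
      (\<forall>x. lg (D x) = min \<bar>lg (mono_eval m x) - lg (mono_eval n x)\<bar> (lg b))"
    and T: "\<And>m n k. (m, n) \<in> I \<Longrightarrow> k \<in> set h \<Longrightarrow> \<exists>T. order_constraint G b m n k T"
    and U: "\<And>m n k. (m, n) \<in> I \<Longrightarrow> k \<in> set g \<Longrightarrow> \<exists>T. order_constraint G b n m k T"
  shows "kernel_gen bounded_rat_funs (poly_eval h / poly_eval g) \<in> lattice_generated G"
proof -
  let ?f = "poly_eval h / poly_eval g"
  have "\<exists>F c. lattice_elem G F \<and> lg_dom ?f F \<and> c \<ge> 0 \<and>
      (\<forall>x. poly_eval h x = mono_eval (fst i) x \<longrightarrow> poly_eval g x = mono_eval (snd i) x \<longrightarrow>
         lg (F x) \<le> c * \<bar>lg (?f x)\<bar>)" if "i \<in> I" for i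
  proof -
    obtain m n where i: "i = (m, n)" by (cases i)
    obtain D where D: "lattice_elem G D"
      "\<And>x. lg (D x) = min \<bar>lg (mono_eval m x) - lg (mono_eval n x)\<bar> (lg b)"
      using D \<open>i \<in> I\<close> i by blast
    obtain T where T: "\<And>k. k \<in> set h \<Longrightarrow> order_constraint G b m n k (T k)"
      using T \<open>i \<in> I\<close> i by metis
    obtain U where U: "\<And>k. k \<in> set g \<Longrightarrow> order_constraint G b n m k (U k)"
      using U \<open>i \<in> I\<close> i by metis
    show ?thesis
      unfolding i fst_conv snd_conv
      using I(1) \<open>i \<in> I\<close> i by (intro ex_cell_elem[OF b _ _ f D T U]) auto
  qed
  then obtain F c where Fc: "\<And>i. i \<in> I \<Longrightarrow> lattice_elem G (F i)" "\<And>i. i \<in> I \<Longrightarrow> lg_dom ?f (F i)"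
    "\<And>i. i \<in> I \<Longrightarrow> 0 \<le> c i"
    "\<And>i x. i \<in> I \<Longrightarrow> poly_eval h x = mono_eval (fst i) x \<Longrightarrow> poly_eval g x = mono_eval (snd i) x \<Longrightarrow>
         lg (F i x) \<le> c i * \<bar>lg (?f x)\<bar>"
    by metis
  have "finite I"
    using I(1) by (rule finite_subset) simp
  moreover have "\<exists>i\<in>I. lg (F i x) \<le> c i * \<bar>lg (?f x)\<bar>" for x
    using I(2)[of x] Fc(4) by fastforce
  ultimately show ?thesis
    using b Fc I(2) by (intro kernel_gen_eq_INT_cells[of b ?f I G F c] f) auto
qed

section \<open>Corner-integral generators\<close>

abbreviation corner_integral_kernels ::
    "(('n::finite \<Rightarrow> 'a::complete_arch_div_semifield) \<Rightarrow> 'a) set set" where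
  "corner_integral_kernels \<equiv>
     {K \<in> PCon bounded_rat_funs. corner_integral_kernel bounded_rat_funs K}"

abbreviation regular_corner_integral_kernels ::
    "(('n::finite \<Rightarrow> 'a::complete_arch_div_semifield) \<Rightarrow> 'a) set set" where
  "regular_corner_integral_kernels \<equiv>
     {K \<in> PCon bounded_rat_funs. regular_kernel bounded_rat_funs K \<and>
        corner_integral_kernel bounded_rat_funs K}"

text \<open>The quotient has logarithm between \<open>0\<close> and \<open>c\<close>, so it is
  bounded. Its reduced form is the same function, so a thin set where \<open>h = G\<close> makes the
  reduced form regular.\<close>

lemma
  fixes h :: "('n::finite, 'a::complete_arch_div_semifield) monomial list"
  assumes b: "1 < (b::'a)" and h: "is_poly h" and G: "G \<in> poly_funs"
    and le: "\<And>x. G x \<le> poly_eval h x"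
    and cr: "\<And>x. corner_root h x \<Longrightarrow> poly_eval h x \<le> G x"
    and bound: "\<And>x. lg (poly_eval h x) \<le> lg (G x) + c"
  shows lattice_elem_fraction: "lattice_elem corner_integral_kernels (poly_eval h / G)"
    and lattice_elem_fraction_regular: "thin {x. poly_eval h x = G x} \<Longrightarrow>
      lattice_elem regular_corner_integral_kernels (poly_eval h / G)"
proof -
  let ?f = "poly_eval h / G"
  have lgf: "0 \<le> lg (?f x)" "lg (?f x) \<le> c" for x
    using le[of x] bound[of x] by (simp_all add: lg_divide flip: lg_le_iff)
  have "?f \<in> rat_funs"
    using h G by (intro rat_funs_divide) (auto simp: poly_funs_def)
  then have S: "?f \<in> bounded_rat_funs"
    using lgf by (auto simp: bounded_rat_funs_def)
  obtain h' g' where red: "reduced_fraction h' g'" and ci: "corner_integral h' g'"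
    and eq: "poly_eval h' / poly_eval g' = ?f"
    using ex_corner_integral_fraction[OF b h G le cr] by blast
  let ?K = "kernel_gen bounded_rat_funs ?f"
  have K: "?K \<in> PCon bounded_rat_funs" "corner_integral_kernel bounded_rat_funs ?K"
    using S red ci eq unfolding PCon_def corner_integral_kernel_def by (blast, metis)
  then show "lattice_elem corner_integral_kernels ?f"
    using S lgf by (simp add: lattice_elem_def lattice_generated.base)
  assume thin: "thin {x. poly_eval h x = G x}"
  have "(poly_eval h' x = poly_eval g' x) = (poly_eval h x = G x)" for x
    using fun_cong[OF eq, of x, THEN arg_cong, of lg] by (simp add: lg_divide flip: lg_eq_iff) linarith
  then have "regular h' g'"
    using thin red by (intro regular_if_thin[OF b]) (auto simp: reduced_fraction_def is_poly_def)
  then have "regular_kernel bounded_rat_funs ?K"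
    using S red eq unfolding regular_kernel_def by metis
  then show "lattice_elem regular_corner_integral_kernels ?f"
    using K S lgf by (simp add: lattice_elem_def lattice_generated.base)
qed

text \<open>A single monomial has no corner roots, so \<open>w / 1\<close> qualifies. This covers
  degenerate cases in which two monomials have equal exponents and hence a constant
  quotient.\<close>

lemma
  fixes w :: "'a::complete_arch_div_semifield"
  assumes b: "1 < (b::'a)" and w: "0 \<le> lg w"
  shows lattice_elem_const: "lattice_elem corner_integral_kernels
      ((\<lambda>_. w) :: ('n::finite \<Rightarrow> 'a) \<Rightarrow> 'a)"
    and lattice_elem_const_regular: "lg w \<noteq> 0 \<Longrightarrow>
      lattice_elem regular_corner_integral_kernels ((\<lambda>_. w) :: ('n::finite \<Rightarrow> 'a) \<Rightarrow> 'a)"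
proof -
  let ?h = "[(w, \<lambda>_. 0)] :: ('n, 'a) monomial list" and ?G = "(\<lambda>_. 1) :: ('n \<Rightarrow> 'a) \<Rightarrow> 'a"
  have h: "poly_eval ?h = (\<lambda>_. w)"
    by (simp add: poly_eval_single mono_eval_const)
  have f: "poly_eval ?h / ?G = (\<lambda>_. w)"
    by (simp add: h fun_eq_iff lg_simps flip: lg_eq_iff)
  have *: "is_poly ?h" "?G x \<le> poly_eval ?h x" "corner_root ?h x \<Longrightarrow> poly_eval ?h x \<le> ?G x"
    "lg (poly_eval ?h x) \<le> lg (?G x) + lg w" for x
    using w unfolding h
    by (auto simp: is_poly_def corner_root_def lg_one simp flip: lg_le_iff)
  show "lattice_elem corner_integral_kernels ((\<lambda>_. w) :: ('n \<Rightarrow> 'a) \<Rightarrow> 'a)"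
    using lattice_elem_fraction[OF b *(1) const_in_poly_funs *(2-4)] unfolding f .
  assume "lg w \<noteq> 0"
  then have "thin {x. poly_eval ?h x = ?G x}"
    by (simp add: h lg_eq_0_iff thin_empty)
  then show "lattice_elem regular_corner_integral_kernels ((\<lambda>_. w) :: ('n \<Rightarrow> 'a) \<Rightarrow> 'a)"
    using lattice_elem_fraction_regular[OF b *(1) const_in_poly_funs *(2-4)] unfolding f by blast
qed

section \<open>Half-spaces, hyperplanes and hypersurfaces\<close>

lemma lg_mono_eval_diff_const:
  fixes m n :: "('n::finite, 'a::complete_arch_div_semifield) monomial"
  assumes "snd m = snd n"
  shows "lg (mono_eval m x) - lg (mono_eval n x) = lg (fst m) - lg (fst n)"
  by (simp add: lg_mono_eval assms)

text \<open>The fraction is \<open>(m + n) / (n + m/b)\<close>. At a corner root of the numerator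
  \<open>m = n\<close>, and there both sides equal \<open>n\<close>; the term \<open>m/b\<close>
  truncates the quotient at \<open>b\<close>. For equal exponents \<open>[m, n]\<close> is no
  polynomial, and a constant takes its place.\<close>

lemma ex_halfspace_elem:
  fixes m n :: "('n::finite, 'a::complete_arch_div_semifield) monomial"
  assumes b: "1 < (b::'a)"
  shows "\<exists>F. lattice_elem corner_integral_kernels F \<and>
    (\<forall>x. lg (F x) = min (max (lg (mono_eval m x) - lg (mono_eval n x)) 0) (lg b))"
proof (cases "snd m = snd n")
  case True
  define w where "w = inverse (inverse (fst m / fst n + 1) + inverse b)"
  have "0 < lg b"
    using lg_strict_mono[OF b] by (simp add: lg_one)
  have w: "lg w = min (max (lg (fst m) - lg (fst n)) 0) (lg b)"
    by (simp add: w_def lg_simps)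
  have "0 \<le> lg w"
    using \<open>0 < lg b\<close> unfolding w by simp
  from lattice_elem_const[OF b this] show ?thesis
    by (intro exI[of _ "\<lambda>_. w"]) (simp add: w lg_mono_eval_diff_const[OF True])
next
  case False
  have lgb: "0 < lg b"
    using lg_strict_mono[OF b] by (simp add: lg_one)
  let ?G = "mono_eval n + (\<lambda>_. inverse b) * mono_eval m"
  have h: "is_poly [m, n]"
    using False by (simp add: is_poly_def)
  have G: "?G \<in> poly_funs"
    by (intro poly_funs_add poly_funs_mult mono_eval_in_poly_funs const_in_poly_funs)
  have lgh: "lg (poly_eval [m, n] x) = max (lg (mono_eval m x)) (lg (mono_eval n x))"
    and lgG: "lg (?G x) = max (lg (mono_eval n x)) (lg (mono_eval m x) - lg b)" for x
    by (simp_all add: poly_eval_def lg_simps)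
  have 1: "?G x \<le> poly_eval [m, n] x" for x
    unfolding lg_le_iff[symmetric] lgG lgh using lgb by linarith
  have 2: "poly_eval [m, n] x \<le> ?G x" if "corner_root [m, n] x" for x
  proof -
    have "mono_eval m x = mono_eval n x"
      using that by (auto simp: corner_root_def)
    then show ?thesis
      unfolding lg_le_iff[symmetric] lgG lgh by simp
  qed
  have 3: "lg (poly_eval [m, n] x) \<le> lg (?G x) + lg b" for x
    using lgb unfolding lgh lgG by linarith
  have "lg ((poly_eval [m, n] / ?G) x) =
      min (max (lg (mono_eval m x) - lg (mono_eval n x)) 0) (lg b)" for x
    unfolding divide_fun_apply lg_divide lgh lgG using lgb by linarith
  then show ?thesis
    using lattice_elem_fraction[OF b h G 1 2 3] by blast
qed

lemma snd_mono_mult_self_eq_iff: "snd (mono_mult m m) = snd (mono_mult n n) \<longleftrightarrow> snd m = snd n"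
  by (simp add: mono_mult_def fun_eq_iff flip: mult_2)

text \<open>Squares make the fraction symmetric: \<open>(m^2 + n^2) / (m n + (m^2 + n^2)/b)\<close>
  equals \<open>1\<close> only where \<open>m = n\<close>, a thin set.\<close>

lemma ex_hyperplane_elem:
  fixes m n :: "('n::finite, 'a::complete_arch_div_semifield) monomial"
  assumes b: "1 < (b::'a)" and mn: "m \<noteq> n"
  shows "\<exists>F. lattice_elem regular_corner_integral_kernels F \<and>
    (\<forall>x. lg (F x) = min \<bar>lg (mono_eval m x) - lg (mono_eval n x)\<bar> (lg b))"
proof (cases "snd m = snd n")
  case True
  define w where "w = inverse (inverse (fst m / fst n + fst n / fst m) + inverse b)"
  have "0 < lg b"
    using lg_strict_mono[OF b] by (simp add: lg_one)
  have w: "lg w = min \<bar>lg (fst m) - lg (fst n)\<bar> (lg b)"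
    unfolding w_def lg_simps by linarith
  have "lg (fst m) \<noteq> lg (fst n)"
    using mn True by (simp add: lg_eq_iff prod_eq_iff)
  then have "0 \<le> lg w" "lg w \<noteq> 0"
    using \<open>0 < lg b\<close> unfolding w by auto
  from lattice_elem_const_regular[OF b this] show ?thesis
    by (intro exI[of _ "\<lambda>_. w"]) (simp add: w lg_mono_eval_diff_const[OF True])
next
  case False
  have lgb: "0 < lg b"
    using lg_strict_mono[OF b] by (simp add: lg_one)
  let ?h = "[mono_mult m m, mono_mult n n]"
  let ?G = "mono_eval m * mono_eval n + (\<lambda>_. inverse b) * poly_eval ?h"
  have h: "is_poly ?h"
    using False by (simp add: is_poly_def snd_mono_mult_self_eq_iff)
  have G: "?G \<in> poly_funs"
    by (intro poly_funs_add poly_funs_mult mono_eval_in_poly_funs const_in_poly_funs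
        poly_eval_in_poly_funs) simp
  have lgh: "lg (poly_eval ?h x) = 2 * max (lg (mono_eval m x)) (lg (mono_eval n x))"
    and lgG: "lg (?G x) = max (lg (mono_eval m x) + lg (mono_eval n x)) (lg (poly_eval ?h x) - lg b)" for x
    by (simp_all add: poly_eval_def mono_eval_mult lg_simps)
  have 1: "?G x \<le> poly_eval ?h x" for x
    unfolding lg_le_iff[symmetric] lgG lgh using lgb by linarith
  have 2: "poly_eval ?h x \<le> ?G x" if "corner_root ?h x" for x
  proof -
    have "lg (mono_eval m x) = lg (mono_eval n x)"
      using that by (auto simp: corner_root_def mono_eval_mult lg_mult simp flip: lg_eq_iff)
    then show ?thesis
      unfolding lg_le_iff[symmetric] lgG lgh by linarith
  qed
  have 3: "lg (poly_eval ?h x) \<le> lg (?G x) + lg b" for x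
    unfolding lgG by linarith
  have "{x. poly_eval ?h x = ?G x} \<subseteq> {x. mono_eval m x = mono_eval n x}"
    using lgb unfolding lg_eq_iff[symmetric] lgG lgh by (auto simp: max_def split: if_splits)
  with thin_mono_eval_eq[OF mn] have 4: "thin {x. poly_eval ?h x = ?G x}"
    by (rule thin_subset)
  have "lg ((poly_eval ?h / ?G) x) = min \<bar>lg (mono_eval m x) - lg (mono_eval n x)\<bar> (lg b)" for x
    unfolding divide_fun_apply lg_divide lgG lgh using lgb by linarith
  then show ?thesis
    using lattice_elem_fraction_regular[OF b h G 1 2 3 4] by blast
qed

text \<open>
  The quotient of the largest by the second largest of three monomials is \<open>1\<close> precisely on the
  tropical hypersurface of their sum, which meets the set where \<open>m = n\<close> in the part where
  \<open>k \<le> m\<close>.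
\<close>

lemma ex_hypersurface_elem:
  fixes k m n :: "('n::finite, 'a::complete_arch_div_semifield) monomial"
  assumes b: "1 < (b::'a)" and km: "snd k \<noteq> snd m" and kn: "snd k \<noteq> snd n" and mn: "snd m \<noteq> snd n"
  shows "\<exists>T. order_constraint regular_corner_integral_kernels b m n k T"
proof -
  have lgb: "0 < lg b"
    using lg_strict_mono[OF b] by (simp add: lg_one)
  let ?h = "[mono_mult k k, mono_mult m m, mono_mult n n]"
  let ?G = "mono_eval m * mono_eval n + (mono_eval k * mono_eval m + mono_eval k * mono_eval n) +
    (\<lambda>_. inverse b) * poly_eval ?h"
  let ?k = "\<lambda>x. lg (mono_eval k x)" and ?m = "\<lambda>x. lg (mono_eval m x)" and ?n = "\<lambda>x. lg (mono_eval n x)"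
  have h: "is_poly ?h"
    using km kn mn by (simp add: is_poly_def snd_mono_mult_self_eq_iff)
  have G: "?G \<in> poly_funs"
    by (intro poly_funs_add poly_funs_mult mono_eval_in_poly_funs const_in_poly_funs
        poly_eval_in_poly_funs) simp
  have lgh: "lg (poly_eval ?h x) = 2 * max (?k x) (max (?m x) (?n x))"
    and lgG: "lg (?G x) = max (max (?m x + ?n x) (max (?k x + ?m x) (?k x + ?n x)))
      (lg (poly_eval ?h x) - lg b)" for x
    by (simp_all add: poly_eval_def mono_eval_mult lg_simps)
  have 1: "?G x \<le> poly_eval ?h x" for x
    unfolding lg_le_iff[symmetric] lgG lgh using lgb by linarith
  \<comment> \<open>At a corner root the largest of the three monomials is attained twice, so some
    mixed product equals its square.\<close>
  have 2: "poly_eval ?h x \<le> ?G x" if "corner_root ?h x" for x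
  proof -
    have "lg (poly_eval ?h x) = 2 * ?k x \<and> ?k x = ?m x \<or>
        lg (poly_eval ?h x) = 2 * ?k x \<and> ?k x = ?n x \<or>
        lg (poly_eval ?h x) = 2 * ?m x \<and> ?m x = ?n x"
      using that by (auto simp: corner_root_def mono_eval_mult lg_mult simp flip: lg_eq_iff)
    then show ?thesis
      unfolding lg_le_iff[symmetric] lgG by linarith
  qed
  have 3: "lg (poly_eval ?h x) \<le> lg (?G x) + lg b" for x
    unfolding lgG by linarith
  have "mono_eval k x = mono_eval m x \<or> mono_eval k x = mono_eval n x \<or> mono_eval m x = mono_eval n x"
    if "poly_eval ?h x = ?G x" for x
    using that lgb unfolding lg_eq_iff[symmetric] lgG lgh by (auto simp: max_def split: if_splits)
  then have "{x. poly_eval ?h x = ?G x} \<subseteq> {x. mono_eval k x = mono_eval m x} \<union>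
      ({x. mono_eval k x = mono_eval n x} \<union> {x. mono_eval m x = mono_eval n x})"
    by blast
  moreover have "thin ({x. mono_eval k x = mono_eval m x} \<union>
      ({x. mono_eval k x = mono_eval n x} \<union> {x. mono_eval m x = mono_eval n x}))"
    using km kn mn by (intro thin_Un thin_mono_eval_eq) auto
  ultimately have 4: "thin {x. poly_eval ?h x = ?G x}"
    using thin_subset by blast
  let ?s = "\<lambda>x. max (?m x + ?n x) (max (?k x + ?m x) (?k x + ?n x))"
  have lgT: "lg ((poly_eval ?h / ?G) x) = min (lg (poly_eval ?h x) - ?s x) (lg b)" for x
    unfolding divide_fun_apply lg_divide lgG by simp
  have 5: "lg ((poly_eval ?h / ?G) x) \<le> 1 * \<bar>?m x - ?n x\<bar>" if "mono_eval k x \<le> mono_eval m x" for x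
  proof -
    have "?k x \<le> ?m x"
      using that by (simp add: lg_le_iff)
    then have "lg (poly_eval ?h x) = 2 * max (?m x) (?n x)"
      unfolding lgh by simp
    moreover have "?m x + ?n x \<le> ?s x"
      by simp
    ultimately show ?thesis
      unfolding lgT by (simp add: min_le_iff_disj abs_real_def max_def)
  qed
  have 6: "?k x \<le> ?m x + lg ((poly_eval ?h / ?G) x) + \<bar>?m x - ?n x\<bar>"
    if "lg ((poly_eval ?h / ?G) x) < lg b" for x
  proof -
    have "lg ((poly_eval ?h / ?G) x) = lg (poly_eval ?h x) - ?s x"
      using that unfolding lgT by (simp add: min_def split: if_splits)
    moreover have "2 * ?k x \<le> lg (poly_eval ?h x)" "2 * ?n x \<le> lg (poly_eval ?h x)"
      unfolding lgh by simp_all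
    \<comment> \<open>If \<open>m n\<close> is the largest mixed product, both \<open>k^2\<close>
      and \<open>n^2\<close> must be compared with it; in the other two cases \<open>k\<close>
      cancels.\<close>
    moreover have "?s x = ?m x + ?n x \<or> ?s x = ?k x + ?m x \<or> ?s x = ?k x + ?n x"
      by (auto simp: max_def)
    ultimately show ?thesis
      by (elim disjE) linarith+
  qed
  show ?thesis
    unfolding order_constraint_def
    by (intro exI[of _ "poly_eval ?h / ?G"] conjI exI[of _ "1::real"] allI impI;
        (rule lattice_elem_fraction_regular[OF b h G 1 2 3 4] zero_le_one | rule 5 6, assumption))
qed

text \<open>If \<open>k \<le> m\<close> keeps \<open>m\<close> and \<open>n\<close> at distance at
  least \<open>r\<close>, the constant \<open>b\<close> is bounded by \<open>lg b / r\<close> times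
  that distance. The last condition of a constraint is vacuous, as \<open>b\<close> is never below
  itself.\<close>

lemma order_constraint_const:
  fixes m n k :: "('n::finite, 'a::complete_arch_div_semifield) monomial"
  assumes b: "1 < (b::'a)" and r: "r > 0"
    "\<And>x. mono_eval k x \<le> mono_eval m x \<Longrightarrow> r \<le> \<bar>lg (mono_eval m x) - lg (mono_eval n x)\<bar>"
  shows "order_constraint regular_corner_integral_kernels b m n k (\<lambda>_. b)"
proof -
  have lgb: "0 < lg b"
    using lg_strict_mono[OF b] by (simp add: lg_one)
  have "lg b \<le> lg b / r * \<bar>lg (mono_eval m x) - lg (mono_eval n x)\<bar>"
    if "mono_eval k x \<le> mono_eval m x" for x
    using mult_left_mono[OF r(2)[OF that], of "lg b / r"] lgb r(1) by simp
  moreover have "0 \<le> lg b / r"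
    using lgb r(1) by simp
  ultimately show ?thesis
    using lattice_elem_const_regular[OF b, of b] lgb unfolding order_constraint_def by auto
qed

text \<open>The hypersurface needs three different exponent vectors. When two coincide, either
  \<open>k\<close> never exceeds \<open>m\<close> by more than the distance between \<open>m\<close>
  and \<open>n\<close>, and \<open>D\<close> serves, or that distance is bounded below where
  \<open>k \<le> m\<close>, and a constant serves.\<close>

lemma ex_order_constraint_regular:
  fixes m n k :: "('n::finite, 'a::complete_arch_div_semifield) monomial"
  assumes b: "1 < (b::'a)" and mn: "m \<noteq> n" and km: "snd k = snd m \<Longrightarrow> k = m"
  shows "\<exists>T. order_constraint regular_corner_integral_kernels b m n k T"
proof -
  let ?d = "\<lambda>x. \<bar>lg (mono_eval m x) - lg (mono_eval n x)\<bar>"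
  obtain D where D: "lattice_elem regular_corner_integral_kernels D" "\<And>x. lg (D x) = min (?d x) (lg b)"
    using ex_hyperplane_elem[OF b mn] by blast
  have D0: "0 \<le> lg (D x)" for x
    using D(1) by (simp add: lattice_elem_def)
  have D_constraint: "order_constraint regular_corner_integral_kernels b m n k D"
    if "\<And>x. lg (mono_eval k x) \<le> lg (mono_eval m x) + ?d x"
  proof -
    have "lg (mono_eval k x) \<le> lg (mono_eval m x) + lg (D x) + ?d x" for x
      using that[of x] D0[of x] by linarith
    moreover have "lg (D x) \<le> 1 * ?d x" for x
      unfolding D(2) by simp
    ultimately show ?thesis
      using D(1) zero_le_one unfolding order_constraint_def by blast
  qed
  consider "k = m" | "snd m = snd n" | "snd k \<noteq> snd m" "snd m \<noteq> snd n" "snd k = snd n"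
    | "snd k \<noteq> snd m" "snd k \<noteq> snd n" "snd m \<noteq> snd n"
    using km by blast
  then show ?thesis
  proof cases
    case 1
    then show ?thesis
      using D_constraint by auto
  next
    case 2
    then have "lg (fst m) - lg (fst n) \<noteq> 0"
      using mn by (simp add: lg_eq_iff prod_eq_iff)
    then have "order_constraint regular_corner_integral_kernels b m n k (\<lambda>_. b)"
      by (intro order_constraint_const[OF b, of "\<bar>lg (fst m) - lg (fst n)\<bar>"])
        (simp_all add: lg_mono_eval_diff_const[OF 2])
    then show ?thesis
      by blast
  next
    case 3
    note kn = lg_mono_eval_diff_const[OF 3(3)]
    show ?thesis
    proof (cases "lg (fst k) \<le> lg (fst n)")
      case True
      have "lg (mono_eval k x) \<le> lg (mono_eval m x) + ?d x" for x
        using True kn[of x] by linarith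
      then show ?thesis
        using D_constraint by blast
    next
      case False
      have "lg (fst k) - lg (fst n) \<le> ?d x" if "mono_eval k x \<le> mono_eval m x" for x
        using that kn[of x] unfolding lg_le_iff[symmetric] by linarith
      then have "order_constraint regular_corner_integral_kernels b m n k (\<lambda>_. b)"
        using False by (intro order_constraint_const[OF b, of "lg (fst k) - lg (fst n)"]) auto
      then show ?thesis
      by blast
    qed
  next
    case 4
    then show ?thesis
      by (rule ex_hypersurface_elem[OF b])
  qed
qed

text \<open>All pairs of monomials are used as cells. Two opposite half-spaces give the hyperplane
  function \<open>D\<close>, and the half-space \<open>k \<le> m\<close> is an order constraint with
  factor \<open>0\<close>.\<close>

lemma kernel_in_lattice_generated:
  fixes h g :: "('n::finite, 'a::complete_arch_div_semifield) monomial list"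
  assumes b: "1 < (b::'a)" and hg: "h \<noteq> []" "g \<noteq> []"
    and f: "poly_eval h / poly_eval g \<in> bounded_rat_funs"
  shows "kernel_gen bounded_rat_funs (poly_eval h / poly_eval g)
    \<in> lattice_generated corner_integral_kernels"
proof (rule kernel_gen_in_lattice_generated[OF b f order.refl])
  fix x
  obtain m n where "m \<in> set h" "poly_eval h x = mono_eval m x" "n \<in> set g" "poly_eval g x = mono_eval n x"
    using hg by (metis poly_eval_attained)
  then show "\<exists>(m, n)\<in>set h \<times> set g. poly_eval h x = mono_eval m x \<and> poly_eval g x = mono_eval n x"
    by (intro bexI[of _ "(m, n)"]) auto
next
  fix m n :: "('n, 'a) monomial"
  obtain F where F: "lattice_elem corner_integral_kernels F"
    "\<And>x. lg (F x) = min (max (lg (mono_eval m x) - lg (mono_eval n x)) 0) (lg b)"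
    using ex_halfspace_elem[OF b] by blast
  obtain F' where F': "lattice_elem corner_integral_kernels F'"
    "\<And>x. lg (F' x) = min (max (lg (mono_eval n x) - lg (mono_eval m x)) 0) (lg b)"
    using ex_halfspace_elem[OF b] by blast
  have "0 < lg b"
    using lg_strict_mono[OF b] by (simp add: lg_one)
  then have "lg ((F * F') x) = min \<bar>lg (mono_eval m x) - lg (mono_eval n x)\<bar> (lg b)" for x
    unfolding times_fun_apply lg_mult F(2) F'(2) by linarith
  then show "\<exists>D. lattice_elem corner_integral_kernels D \<and>
      (\<forall>x. lg (D x) = min \<bar>lg (mono_eval m x) - lg (mono_eval n x)\<bar> (lg b))"
    using lattice_elem_mult[OF less_imp_neq[OF b, symmetric] F(1) F'(1)] by blast
next
  have *: "\<exists>T. order_constraint corner_integral_kernels b m n k T" for m n k :: "('n, 'a) monomial"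
  proof -
    obtain T where T: "lattice_elem corner_integral_kernels T"
      "\<And>x. lg (T x) = min (max (lg (mono_eval k x) - lg (mono_eval m x)) 0) (lg b)"
      using ex_halfspace_elem[OF b] by blast
    have "lg (T x) \<le> 0 * \<bar>lg (mono_eval m x) - lg (mono_eval n x)\<bar>"
      if "mono_eval k x \<le> mono_eval m x" for x
      using that unfolding T(2) lg_le_iff[symmetric] by linarith
    moreover have "lg (mono_eval k x) \<le> lg (mono_eval m x) + lg (T x) +
        \<bar>lg (mono_eval m x) - lg (mono_eval n x)\<bar>" if "lg (T x) < lg b" for x
      using that unfolding T(2) by linarith
    ultimately have "order_constraint corner_integral_kernels b m n k T"
      using T(1) order.refl[of "0::real"] unfolding order_constraint_def by blast
    then show ?thesis
      by blast
  qed
  show "\<exists>T. order_constraint corner_integral_kernels b m n k T"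
    "\<exists>T. order_constraint corner_integral_kernels b n m k T" for m n k :: "('n, 'a) monomial"
    by (fact *)+
qed

text \<open>By regularity the cells with \<open>m \<noteq> n\<close> already cover all points.
  Distinct exponents within each polynomial exclude a different monomial parallel to the maximal
  one.\<close>

lemma regular_kernel_in_lattice_generated:
  fixes h g :: "('n::finite, 'a::complete_arch_div_semifield) monomial list"
  assumes b: "1 < (b::'a)" and hg: "is_poly h" "is_poly g" and reg: "regular h g"
    and f: "poly_eval h / poly_eval g \<in> bounded_rat_funs"
  shows "kernel_gen bounded_rat_funs (poly_eval h / poly_eval g)
    \<in> lattice_generated regular_corner_integral_kernels"
proof (rule kernel_gen_in_lattice_generated[OF b f, of "{(m, n) \<in> set h \<times> set g. m \<noteq> n}"])
  fix x
  obtain m n where "m \<in> set h" "n \<in> set g" "poly_eval h x = mono_eval m x"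
    "poly_eval g x = mono_eval n x" "m \<noteq> n"
    using reg unfolding regular_def by blast
  then show "\<exists>(m, n)\<in>{(m, n) \<in> set h \<times> set g. m \<noteq> n}.
      poly_eval h x = mono_eval m x \<and> poly_eval g x = mono_eval n x"
    by (intro bexI[of _ "(m, n)"]) auto
next
  fix m n k
  assume mn: "(m, n) \<in> {(m, n) \<in> set h \<times> set g. m \<noteq> n}"
  then show "\<exists>D. lattice_elem regular_corner_integral_kernels D \<and>
      (\<forall>x. lg (D x) = min \<bar>lg (mono_eval m x) - lg (mono_eval n x)\<bar> (lg b))"
    by (intro ex_hyperplane_elem[OF b]) auto
  have inj: "inj_on snd (set h)" "inj_on snd (set g)"
    using hg by (auto simp: is_poly_def distinct_map)
  show "\<exists>T. order_constraint regular_corner_integral_kernels b m n k T" if "k \<in> set h"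
    using mn that inj(1) by (intro ex_order_constraint_regular[OF b]) (auto dest: inj_onD)
  show "\<exists>T. order_constraint regular_corner_integral_kernels b n m k T" if "k \<in> set g"
    using mn that inj(2) by (intro ex_order_constraint_regular[OF b]) (auto dest: inj_onD)
qed auto

section \<open>Closure of principal and of regular kernels under the lattice operations\<close>

lemma kernel_gen_in_PCon: "f \<in> R \<Longrightarrow> kernel_gen R f \<in> PCon R"
  unfolding PCon_def by blast

lemma lattice_generated_subset_PCon:
  fixes K :: "(('n::finite \<Rightarrow> 'a::complete_arch_div_semifield) \<Rightarrow> 'a) set"
  assumes R: "subsemifield R" and "K \<in> lattice_generated G" and G: "G \<subseteq> PCon R"
  shows "K \<in> PCon R"
  using assms(2)
proof (induction rule: lattice_generated.induct)
  case (base K)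
  then show ?case
    using G by blast
next
  case (prod K L)
  then obtain a c where ac: "K = kernel_gen R a" "L = kernel_gen R c" "a \<in> R" "c \<in> R"
    by (auto simp: PCon_def)
  then show ?case
    unfolding ac(1,2) kernel_gen_times[OF R ac(3,4)]
    by (intro kernel_gen_in_PCon subsemifieldD[OF R] ac)
next
  case (inter K L)
  then obtain a c where ac: "K = kernel_gen R a" "L = kernel_gen R c" "a \<in> R" "c \<in> R"
    by (auto simp: PCon_def)
  then show ?case
    unfolding ac(1,2) kernel_gen_Int[OF R ac(3,4)]
    by (intro kernel_gen_in_PCon subsemifieldD[OF R] ac)
qed

text \<open>This describes regularity by the set where a generator equals \<open>1\<close>, so it
  can be checked on the explicit generators of products and intersections without finding reduced
  fractions for them.\<close>

lemma regular_kernel_iff_thin: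
  fixes K :: "(('n::finite \<Rightarrow> 'a::complete_arch_div_semifield) \<Rightarrow> 'a) set"
  assumes b: "1 < (b::'a)" and S: "S \<subseteq> rat_funs"
  shows "regular_kernel S K \<longleftrightarrow> (\<exists>f\<in>S. K = kernel_gen S f \<and> thin {x. f x = 1})"
proof
  have eq: "{x. (poly_eval h / poly_eval g) x = 1} = {x. poly_eval h x = poly_eval g x}"
    for h g :: "('n, 'a) monomial list"
    by (simp add: lg_simps flip: lg_eq_iff)
  show "\<exists>f\<in>S. K = kernel_gen S f \<and> thin {x. f x = 1}" if K: "regular_kernel S K"
  proof -
    obtain h g where hg: "regular h g" "poly_eval h / poly_eval g \<in> S"
      "K = kernel_gen S (poly_eval h / poly_eval g)"
      using K unfolding regular_kernel_def by (elim exE conjE)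
    have "thin {x. (poly_eval h / poly_eval g) x = 1}"
      unfolding eq by (rule thin_if_regular[OF hg(1)])
    then show ?thesis
      using hg(2,3) by (intro bexI[of _ "poly_eval h / poly_eval g"] conjI)
  qed
  assume "\<exists>f\<in>S. K = kernel_gen S f \<and> thin {x. f x = 1}"
  then obtain f where f: "f \<in> S" "K = kernel_gen S f" "thin {x. f x = 1}"
    by blast
  then obtain h g where hg: "f = poly_eval h / poly_eval g" "is_poly h" "is_poly g"
    using S by (fastforce simp: rat_funs_def poly_funs_def)
  obtain h' g' d where *: "reduced_fraction h' g'" "poly_eval h = d * poly_eval h'"
    "poly_eval g = d * poly_eval g'"
    using ex_reduced_fraction[OF b hg(2,3)] by blast
  have f': "f = poly_eval h' / poly_eval g'"
    unfolding hg(1) *(2,3) by (simp add: fun_eq_iff lg_simps flip: lg_eq_iff)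
  have "regular h' g'"
    using f(3) *(1) unfolding f' eq
    by (intro regular_if_thin[OF b]) (auto simp: reduced_fraction_def is_poly_def)
  then show "regular_kernel S K"
    unfolding regular_kernel_def using *(1) f(1,2)
    by (intro exI[of _ h'] exI[of _ g'] conjI) (simp_all only: f')
qed

text \<open>The generator of a product equals \<open>1\<close> only where \<open>f\<close> does;
  that of an intersection equals \<open>1\<close> only where \<open>f\<close> or \<open>g\<close>
  does. Both sets are thin.\<close>

lemma lattice_generated_regular:
  fixes K :: "(('n::finite \<Rightarrow> 'a::complete_arch_div_semifield) \<Rightarrow> 'a) set"
  assumes b: "1 < (b::'a)" and R: "subsemifield S" "S \<subseteq> rat_funs"
    and "K \<in> lattice_generated G" and G: "\<And>K. K \<in> G \<Longrightarrow> regular_kernel S K"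
  shows "regular_kernel S K"
  using assms(4)
proof (induction rule: lattice_generated.induct)
  case (base K)
  then show ?case
    by (rule G)
next
  case (prod K L)
  then obtain f g where fg: "K = kernel_gen S f" "f \<in> S" "thin {x. f x = 1}" "L = kernel_gen S g" "g \<in> S"
    unfolding regular_kernel_iff_thin[OF b R(2)] by blast
  let ?c = "(f + inverse f) * (g + inverse g)"
  have "{x. ?c x = 1} \<subseteq> {x. f x = 1}"
  proof
    fix x assume "x \<in> {x. ?c x = 1}"
    then have "lg (?c x) = 0"
      by (simp add: lg_one)
    then have "lg (f x) = 0"
      unfolding times_fun_apply plus_fun_apply inverse_fun_apply lg_mult lg_add lg_inverse by linarith
    then show "x \<in> {x. f x = 1}"
      by (simp add: lg_eq_0_iff)
  qed
  then have "thin {x. ?c x = 1}"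
    using fg(3) thin_subset by blast
  moreover have "?c \<in> S"
    using fg by (simp add: subsemifieldD[OF R(1)])
  ultimately show ?case
    unfolding regular_kernel_iff_thin[OF b R(2)] fg(1,4) kernel_gen_times[OF R(1) fg(2,5)] by blast
next
  case (inter K L)
  then obtain f g where fg: "K = kernel_gen S f" "f \<in> S" "thin {x. f x = 1}"
    "L = kernel_gen S g" "g \<in> S" "thin {x. g x = 1}"
    unfolding regular_kernel_iff_thin[OF b R(2)] by blast
  let ?c = "inverse (inverse (f + inverse f) + inverse (g + inverse g))"
  have "{x. ?c x = 1} \<subseteq> {x. f x = 1} \<union> {x. g x = 1}"
  proof
    fix x assume "x \<in> {x. ?c x = 1}"
    then have "lg (?c x) = 0"
      by (simp add: lg_one)
    then have "lg (f x) = 0 \<or> lg (g x) = 0"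
      unfolding plus_fun_apply inverse_fun_apply lg_add lg_inverse by linarith
    then show "x \<in> {x. f x = 1} \<union> {x. g x = 1}"
      by (simp add: lg_eq_0_iff)
  qed
  then have "thin {x. ?c x = 1}"
    using thin_Un[OF fg(3,6)] thin_subset by blast
  moreover have "?c \<in> S"
    using fg by (simp add: subsemifieldD[OF R(1)])
  ultimately show ?case
    unfolding regular_kernel_iff_thin[OF b R(2)] fg(1,4) kernel_gen_Int[OF R(1) fg(2,5)] by blast
qed

theorem theorem0p13p5p2:
  fixes \<alpha> :: "'a::complete_arch_div_semifield"
    and S :: "(('n::finite \<Rightarrow> 'a) \<Rightarrow> 'a) set"
  assumes "\<alpha> \<noteq> 1"
    and "S = kernel_gen rat_funs (\<lambda>_. \<alpha>)"
  shows "lattice_generated {K \<in> PCon S. corner_integral_kernel S K} = PCon S \<and>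
    lattice_generated {K \<in> PCon S. regular_kernel S K \<and> corner_integral_kernel S K}
      = {K \<in> PCon S. regular_kernel S K}"
proof -
  \<comment> \<open>The larger of \<alpha> and its inverse, which exceeds \<open>1\<close> because
    \<alpha> differs from \<open>1\<close>.\<close>
  define b where "b = \<alpha> + inverse \<alpha>"
  have "0 < lg b"
    using assms(1) by (simp add: b_def lg_simps lg_eq_0_iff[symmetric])
  then have b: "1 < b"
    by (simp add: lg_one flip: lg_less_iff)
  have S: "S = bounded_rat_funs"
    using assms by (simp add: kernel_gen_const)
  have R: "subsemifield S"
    unfolding S using assms(1) by (rule subsemifield_bounded_rat_funs)
  have SR: "S \<subseteq> rat_funs"
    by (auto simp: S bounded_rat_funs_def)
  let ?G1 = "{K \<in> PCon S. corner_integral_kernel S K}"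
  let ?G2 = "{K \<in> PCon S. regular_kernel S K \<and> corner_integral_kernel S K}"
  have "lattice_generated ?G1 = PCon S"
  proof (intro equalityI subsetI)
    fix K assume "K \<in> PCon S"
    then obtain f where f: "f \<in> S" "K = kernel_gen S f"
      by (auto simp: PCon_def)
    then obtain h g where hg: "f = poly_eval h / poly_eval g" "h \<noteq> []" "g \<noteq> []"
      using SR by (fastforce simp: rat_funs_def poly_funs_def is_poly_def)
    show "K \<in> lattice_generated ?G1"
      using f kernel_in_lattice_generated[OF b hg(2,3)] unfolding hg(1) S by simp
  next
    fix K assume "K \<in> lattice_generated ?G1"
    then show "K \<in> PCon S"
      by (rule lattice_generated_subset_PCon[OF R]) simp
  qed
  moreover have "lattice_generated ?G2 = {K \<in> PCon S. regular_kernel S K}"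
  proof (intro equalityI subsetI)
    fix K assume "K \<in> {K \<in> PCon S. regular_kernel S K}"
    then obtain h g where hg: "reduced_fraction h g" "regular h g" "poly_eval h / poly_eval g \<in> S"
      "K = kernel_gen S (poly_eval h / poly_eval g)"
      unfolding regular_kernel_def by (elim CollectE exE conjE)
    then show "K \<in> lattice_generated ?G2"
      using regular_kernel_in_lattice_generated[OF b, of h g] unfolding reduced_fraction_def S
      by simp
  next
    fix K assume K: "K \<in> lattice_generated ?G2"
    then have "K \<in> PCon S"
      by (rule lattice_generated_subset_PCon[OF R]) auto
    moreover have "regular_kernel S K"
      by (rule lattice_generated_regular[OF b R SR K]) simp
    ultimately show "K \<in> {K \<in> PCon S. regular_kernel S K}"
      by simp
  qed
  ultimately show ?thesis ..
qed

end
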